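(* Assume that (A1)–(A5), as written out in the context, hold, fix $t>0$, and let $v(\cdot)$, $\varphi$, $\tilde h$, $n_0$ be as defined in the context. For $1\le i\le n_0$ and $t_{i-1}<s\le t_i$, $$v(s)=\int_s^{t_i}\varphi(u)\,du+\int_s^{t_i}Q(u)v(u)\,du+v(t_i),$$ where $v(t_{n_0})=0$. Furthermore, $v(\cdot)$ is a.e. differentiable, and for $1\le i\le n_0$ and $0\le s<t_i-t_{i-1}$, $$\frac{d}{ds}v(t_i-s)=\varphi(t_i-s)+Q(t_i-s)v(t_i-s)\quad\text{a.e.},$$ and $v(t_i)=\tilde h(t_i)+v(t_i+)$ for $1\le i\le n_0$ (where $v(t+)=0$).
   Context: Setting. $X=(X(t):t\ge 0)$ is a right-continuous Markov jump process on a finite set $S$, $|S|=d<\infty$, with time-dependent rate matrices $Q(t)=(Q(t,x,y):x,y\in S)$ (nonnegative off-diagonal entries, rows summing to $0$) and transition matrices $P(s,t)=(P(s,t,x,y):x,y\in S)$, $P(s,t,x,y)=\mathbb P(X(t)=y\mid X(s)=x)$, $0\le s\le t$. $r(t,x)$ is a reward rate function, $\beta(t,x)$ an intensity function, and $G(t,x,y,\cdot)$, $H(t,x,\cdot)$, $K(t,x,\cdot)$ ($t\ge0$, $x,y\in S$) are given families of distribution functions (of lump-sum rewards received respectively at a jump of $X$ from $x$ to $y$ at time $t$; at a scheduled time $t$ with $X(t)=x$; at an event time $t$, with $X(t)=x$, of a Poisson process with intensity $\beta(t,X(t))$). $0=t_0<t_1<t_2<\cdots$ are deterministic scheduled times with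 $t_i\to\infty$, and $n(t)=\sup\{i\ge0:t_i\le t\}$. Functions on $S$ are column vectors. Assumptions. (A1) For $x,y\in S$, $z\in\mathbb R$, the functions $Q(\cdot,x,y)$, $r(\cdot,x)$, $G(\cdot,x,y,z)$, $K(\cdot,x,z)$, $\beta(\cdot,x)$ are measurable. (A2) $\mathcal B=\{(x,y):Q(t,x,y)>0\}$ does not depend on $t$, and $Q(1)$ (hence every $Q(t)$) is an irreducible rate matrix. (A3) For each $(x,y)\in\mathcal B$, $0<\inf_{t\ge0}Q(t,x,y)\le\sup_{t\ge0}Q(t,x,y)<\infty$. (A4) There is a finite-valued function $c=(c(x):x\in S)$ such that for all $x\in S$ (and $y \in S$): $0\le\inf_{t}r(t,x)\le\sup_t r(t,x)<\infty$; $0\le\inf_t\beta(t,x)\le\sup_t\beta(t,x)<\infty$; $\sup_t G(t,x,y,0-)=0$ and $\inf_t G(t,x,y,c(x))=1$; $\sup_t H(t,x,0-)=0$ and $\inf_t H(t,x,c(x))=1$; $\sup_t K(t,x,0-)=0$ and $\inf_t K(t,x,c(x))=1$ (i.e. lump-sum rewards take values in $[0,c(x)]$). Moreover, with $\gamma_1(t,x)=\sum_{y:(x,y)\in\mathcal B}Q(t,x,y)\int_0^\infty zG(t,x,y,dz)$, $\gamma_2(t,x)=\beta(t,x)\int_0^\infty zK(t,x,dz)$ and $\gamma=\gamma_1+\gamma_2$, one has $\inf_{t\ge0}r(t,x)+\inf_{t\ge0}\gamma(t,x)>0$ for all $x\in S$. (A5) $\inf\{t_i-t_{i-1}:i\ge1\}>0$.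 Definitions for fixed $t>0$. $\tilde r(u,x)=r(u,x)+\gamma(u,x)$ and $h(t_i,x)=\int_0^\infty zH(t_i,x,dz)$. Let $n_0=n(t)+1$; for the purposes of this statement the scheduled times up to $t$ are taken to be $t_0=0,t_1,\dots,t_{n_0-1}$, together with $t_{n_0}=t$ (replacing the original $t_{n_0}$), with the convention that $h$ and the function $\tilde h$ below vanish identically at $t_0=0$ and at $t_{n_0}=t$. For $0\le s\le t$ and $x\in S$, $$m(s)=\int_s^tP(s,u)\tilde r(u)\,du+\sum_{s\le t_i\le t}P(s,t_i)h(t_i),$$ $$\varphi(s,x)=2r(s,x)m(s,x)+\sum_{y:(x,y)\in\mathcal B}Q(s,x,y)\Big(\int_0^\infty z^2G(s,x,y,dz)+2m(s,y)\int_0^\infty zG(s,x,y,dz)\Big)+\beta(s,x)\Big(\int_0^\infty z^2K(s,x,dz)+2m(s,x)\int_0^\infty zK(s,x,dz)\Big),$$ $$\tilde h(t_i,x)=\int_0^\infty z^2H(t_i,x,dz)+2m(t_i,x)h(t_i,x),$$ $$v(s)=\int_s^tP(s,u)\varphi(u)\,du+\sum_{s\le t_i\le t}P(s,t_i)\tilde h(t_i).$$ $v(s+)$ denotes the right limit of $v$ at $s<t$. *)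

theory Defs
  imports "HOL-Probability.Probability"
begin

definition rate_matrix :: "real^'s^'s::finite \<Rightarrow> bool" where
  "rate_matrix A \<longleftrightarrow>
     (\<forall>x y. x \<noteq> y \<longrightarrow> 0 \<le> A $ x $ y) \<and> (\<forall>x. (\<Sum>y\<in>UNIV. A $ x $ y) = 0)"

definition stochastic_matrix :: "real^'s^'s::finite \<Rightarrow> bool" where
  "stochastic_matrix A \<longleftrightarrow>
     (\<forall>x y. 0 \<le> A $ x $ y) \<and> (\<forall>x. (\<Sum>y\<in>UNIV. A $ x $ y) = 1)"

definition positive_entries :: "real^'s^'s::finite \<Rightarrow> ('s \<times> 's) set" where
  "positive_entries A = {(x, y). 0 < A $ x $ y}"

definition irreducible_rate_matrix :: "real^'s^'s::finite \<Rightarrow> bool" where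
  "irreducible_rate_matrix A \<longleftrightarrow>
     rate_matrix A \<and> (\<forall>x y. (x, y) \<in> (positive_entries A)\<^sup>*)"

definition distribution_function :: "(real \<Rightarrow> real) \<Rightarrow> bool" where
  "distribution_function F \<longleftrightarrow>
     mono F \<and> (\<forall>a. continuous (at_right a) F) \<and>
     (F \<longlongrightarrow> 0) at_bot \<and> (F \<longlongrightarrow> 1) at_top"

text \<open>The Stieltjes integral of \<open>z ^ k\<close> over \<open>[0, \<infinity>)\<close> with respect to \<open>F\<close>.\<close>

definition moment :: "nat \<Rightarrow> (real \<Rightarrow> real) \<Rightarrow> real" where
  "moment k F = (LINT z:{0..}|interval_measure F. z ^ k)"

text \<open>
  A time-inhomogeneous Markov jump process \<open>X\<close> on a finite state space (the universe of the
  type of states), with transition matrices \<open>P\<close> and rate matrices \<open>Q\<close>.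

  Conditional probabilities determine \<open>P s t $ x\<close> only for states \<open>x\<close> that \<open>X s\<close> charges, so
  \<open>P\<close> is required to be a family of transition matrices in its own right.  As \<open>Q\<close> is merely
  measurable in time, \<open>P s (s + h) = I + h Q s + o(h)\<close> can be expected for almost every \<open>s\<close>
  only; that \<open>Q\<close> is the family of rates of \<open>P\<close> is therefore expressed by the forward equation
  in integrated form.
\<close>

locale markov_jump_process = prob_space M
  for M :: "'w measure"
    and X :: "real \<Rightarrow> 'w \<Rightarrow> 's::finite"
    and Q :: "real \<Rightarrow> real^'s^'s"
    and P :: "real \<Rightarrow> real \<Rightarrow> real^'s^'s" +
  assumes random_states: "\<And>t. 0 \<le> t \<Longrightarrow> X t \<in> M \<rightarrow>\<^sub>M count_space UNIV"
    and right_continuous: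
      "\<And>\<omega> t. \<omega> \<in> space M \<Longrightarrow> 0 \<le> t \<Longrightarrow> eventually (\<lambda>u. X u \<omega> = X t \<omega>) (at_right t)"
    and left_limits:
      "\<And>\<omega> t. \<omega> \<in> space M \<Longrightarrow> 0 < t \<Longrightarrow> \<exists>y. eventually (\<lambda>u. X u \<omega> = y) (at_left t)"
    and markov:
      "\<And>s t A x y. 0 \<le> s \<Longrightarrow> s \<le> t \<Longrightarrow>
         A \<in> sigma_sets (space M) {X u -` {z} \<inter> space M |u z. 0 \<le> u \<and> u \<le> s} \<Longrightarrow>
         0 < prob {\<omega> \<in> space M. \<omega> \<in> A \<and> X s \<omega> = x} \<Longrightarrow>
         cond_prob M (\<lambda>\<omega>. X t \<omega> = y) (\<lambda>\<omega>. \<omega> \<in> A \<and> X s \<omega> = x) =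
         cond_prob M (\<lambda>\<omega>. X t \<omega> = y) (\<lambda>\<omega>. X s \<omega> = x)"
    and transition_probability:
      "\<And>s t x y. 0 \<le> s \<Longrightarrow> s \<le> t \<Longrightarrow> 0 < prob {\<omega> \<in> space M. X s \<omega> = x} \<Longrightarrow>
         P s t $ x $ y = cond_prob M (\<lambda>\<omega>. X t \<omega> = y) (\<lambda>\<omega>. X s \<omega> = x)"
    and stochastic: "\<And>s t. 0 \<le> s \<Longrightarrow> s \<le> t \<Longrightarrow> stochastic_matrix (P s t)"
    and chapman_kolmogorov:
      "\<And>s u t. 0 \<le> s \<Longrightarrow> s \<le> u \<Longrightarrow> u \<le> t \<Longrightarrow> P s t = P s u ** P u t"
    and rate_matrices: "\<And>t. 0 \<le> t \<Longrightarrow> rate_matrix (Q t)"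
    and forward_integrable:
      "\<And>s t. 0 \<le> s \<Longrightarrow> s \<le> t \<Longrightarrow> set_integrable lborel {s..t} (\<lambda>u. P s u ** Q u)"
    and forward_equation:
      "\<And>s t. 0 \<le> s \<Longrightarrow> s \<le> t \<Longrightarrow> P s t = mat 1 + (LBINT u:{s..t}. P s u ** Q u)"

text \<open>
  In the following \<open>T\<close> is the sequence of scheduled times, and the definitions that take a
  first argument \<open>t\<close> depend on the time horizon \<open>t\<close>.
\<close>

locale reward_data =
  fixes Q :: "real \<Rightarrow> real^'s^'s::finite"
    and P :: "real \<Rightarrow> real \<Rightarrow> real^'s^'s"
    and r \<beta> :: "real \<Rightarrow> real^'s"
    and G :: "real \<Rightarrow> 's \<Rightarrow> 's \<Rightarrow> real \<Rightarrow> real"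
    and H K :: "real \<Rightarrow> 's \<Rightarrow> real \<Rightarrow> real"
    and T :: "nat \<Rightarrow> real"
begin

text \<open>
  The set of pairs of states with positive rate is assumed below not to depend on time, so that
  evaluating it at time \<open>1\<close> is immaterial.
\<close>

definition jumps :: "('s \<times> 's) set" where
  "jumps = positive_entries (Q 1)"

definition \<gamma> :: "real \<Rightarrow> real^'s" where
  "\<gamma> u = (\<chi> x. (\<Sum>y | (x, y) \<in> jumps. Q u $ x $ y * moment 1 (G u x y)) +
              \<beta> u $ x * moment 1 (K u x))"

definition r_tilde :: "real \<Rightarrow> real^'s" where
  "r_tilde u = r u + \<gamma> u"

definition n0 :: "real \<Rightarrow> nat" where
  "n0 t = Sup {i. T i \<le> t} + 1"

definition \<tau> :: "real \<Rightarrow> nat \<Rightarrow> real" where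
  "\<tau> t i = (if i = n0 t then t else T i)"

text \<open>
  The convention that \<open>h\<close> and \<open>h_tilde\<close> vanish at the times \<open>0\<close> and \<open>t\<close> is part of their
  definition.  It also applies if \<open>t\<close> happens to be one of the scheduled times.
\<close>

definition h :: "real \<Rightarrow> real \<Rightarrow> real^'s" where
  "h t u = (if u = 0 \<or> u = t then 0 else (\<chi> x. moment 1 (H u x)))"

definition m :: "real \<Rightarrow> real \<Rightarrow> real^'s" where
  "m t s = (LBINT u:{s..t}. P s u *v r_tilde u) +
     (\<Sum>i | i \<le> n0 t \<and> s \<le> \<tau> t i \<and> \<tau> t i \<le> t. P s (\<tau> t i) *v h t (\<tau> t i))"

definition \<phi> :: "real \<Rightarrow> real \<Rightarrow> real^'s" where
  "\<phi> t s = (\<chi> x.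
     2 * r s $ x * m t s $ x +
     (\<Sum>y | (x, y) \<in> jumps.
        Q s $ x $ y * (moment 2 (G s x y) + 2 * m t s $ y * moment 1 (G s x y))) +
     \<beta> s $ x * (moment 2 (K s x) + 2 * m t s $ x * moment 1 (K s x)))"

definition h_tilde :: "real \<Rightarrow> real \<Rightarrow> real^'s" where
  "h_tilde t u = (if u = 0 \<or> u = t then 0
     else (\<chi> x. moment 2 (H u x) + 2 * m t u $ x * h t u $ x))"

definition v :: "real \<Rightarrow> real \<Rightarrow> real^'s" where
  "v t s = (LBINT u:{s..t}. P s u *v \<phi> t u) +
     (\<Sum>i | i \<le> n0 t \<and> s \<le> \<tau> t i \<and> \<tau> t i \<le> t. P s (\<tau> t i) *v h_tilde t (\<tau> t i))"

definition v_plus :: "real \<Rightarrow> real \<Rightarrow> real^'s" where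
  "v_plus t s = (if s < t then Lim (at_right s) (v t) else 0)"

end

locale markov_reward_model =
  markov_jump_process M X Q P + reward_data Q P r \<beta> G H K T
  for M :: "'w measure"
    and X :: "real \<Rightarrow> 'w \<Rightarrow> 's::finite"
    and Q :: "real \<Rightarrow> real^'s^'s"
    and P :: "real \<Rightarrow> real \<Rightarrow> real^'s^'s"
    and r \<beta> :: "real \<Rightarrow> real^'s"
    and G :: "real \<Rightarrow> 's \<Rightarrow> 's \<Rightarrow> real \<Rightarrow> real"
    and H K :: "real \<Rightarrow> 's \<Rightarrow> real \<Rightarrow> real"
    and T :: "nat \<Rightarrow> real" +
  assumes distribution_functions:
      "\<And>t x y. 0 \<le> t \<Longrightarrow> distribution_function (G t x y)"
      "\<And>t x. 0 \<le> t \<Longrightarrow> distribution_function (H t x)"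
      "\<And>t x. 0 \<le> t \<Longrightarrow> distribution_function (K t x)"
    and scheduled_times: "T 0 = 0" "strict_mono T" "filterlim T at_top sequentially"
    and measurable_in_time:
      "\<And>x y. (\<lambda>t. Q t $ x $ y) \<in> borel_measurable (restrict_space borel {0..})"
      "\<And>x. (\<lambda>t. r t $ x) \<in> borel_measurable (restrict_space borel {0..})"
      "\<And>x y z. (\<lambda>t. G t x y z) \<in> borel_measurable (restrict_space borel {0..})"
      "\<And>x z. (\<lambda>t. K t x z) \<in> borel_measurable (restrict_space borel {0..})"
      "\<And>x. (\<lambda>t. \<beta> t $ x) \<in> borel_measurable (restrict_space borel {0..})"
    and constant_jumps: "\<And>t. 0 \<le> t \<Longrightarrow> positive_entries (Q t) = jumps"
    and irreducible: "irreducible_rate_matrix (Q 1)"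
    and rate_bounds:
      "\<And>x y. (x, y) \<in> jumps \<Longrightarrow> 0 < (INF t\<in>{0..}. Q t $ x $ y)"
      "\<And>x y. (x, y) \<in> jumps \<Longrightarrow> bdd_above ((\<lambda>t. Q t $ x $ y) ` {0..})"
    and reward_rate_bounds:
      "\<And>t x. 0 \<le> t \<Longrightarrow> 0 \<le> r t $ x"
      "\<And>x. bdd_above ((\<lambda>t. r t $ x) ` {0..})"
    and intensity_bounds:
      "\<And>t x. 0 \<le> t \<Longrightarrow> 0 \<le> \<beta> t $ x"
      "\<And>x. bdd_above ((\<lambda>t. \<beta> t $ x) ` {0..})"
    and lump_sum_bounds:
      "\<exists>c :: 's \<Rightarrow> real. \<forall>x.
         (\<forall>y. (SUP t\<in>{0..}. Lim (at_left 0) (G t x y)) = 0 \<and> (INF t\<in>{0..}. G t x y (c x)) = 1) \<and>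
         (SUP t\<in>{0..}. Lim (at_left 0) (H t x)) = 0 \<and> (INF t\<in>{0..}. H t x (c x)) = 1 \<and>
         (SUP t\<in>{0..}. Lim (at_left 0) (K t x)) = 0 \<and> (INF t\<in>{0..}. K t x (c x)) = 1"
    and positive_reward: "\<And>x. 0 < (INF t\<in>{0..}. r t $ x) + (INF t\<in>{0..}. \<gamma> t $ x)"
    and separated_times: "0 < (INF i\<in>{1..}. T i - T (i - 1))"

end

theory Submission
  imports Defs
begin

text \<open>
  Between two consecutive scheduled times the function \<open>v\<close> satisfies
  \<open>v(s) = \<integral>\<^sub>s\<^sup>y P(s,u) \<phi>(u) du + P(s,y) v(y)\<close>, by Chapman-Kolmogorov.  As \<open>P(s,u) = I + O(u - s)\<close>
  and \<open>P(s,y) - I = \<integral>\<^sub>s\<^sup>y P(s,u) Q(u) du\<close> with bounded rates, \<open>v\<close> is Lipschitz there and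
  \<open>v(s) - v(y) = \<integral>\<^sub>s\<^sup>y (\<phi> + Q v) du + O((y - s)\<^sup>2)\<close>.  A function with increments \<open>O((y - s)\<^sup>2)\<close> is constant,
  which gives the integral equation; the statement about derivatives then is Lebesgue's differentiation
  theorem, here for bounded functions on the line.  The term of the sum that drops out
  when \<open>s\<close> passes \<open>t\<^sub>i\<close> is the jump of \<open>v\<close>.  Since \<open>m\<close> has the same form as \<open>v\<close>, the same argument
  makes \<open>m\<close>, and with it \<open>\<phi>\<close>, bounded and measurable.
\<close>

text \<open>The obstacle is a mismatch of variables: the rates enter through an integrated forward
  equation, which varies the later time of \<open>P s t\<close>, while the claim varies the earlier
  one. With merely measurable rates, a pointwise backward equation cannot be expected at every time.
  The way around is to freeze the vector \<open>v(y)\<close> at the right end of a short interval,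
  to apply the forward equation to this fixed vector, and to compare integrals only. The errors are
  then quadratic around every point, without exceptional set, and the defect of the equation has
  derivative zero everywhere. Null sets enter only when the finished integral equation is
  differentiated.\<close>

section \<open>Lebesgue differentiation on the line\<close>

text \<open>
  Cover the set by intervals on which the average of \<open>f\<close> is at least \<open>q\<close>, inside an open set that exceeds
  \<open>{f < p}\<close> by little.  Over a disjoint Vitali subfamily \<open>U\<close>, \<open>f\<close> integrates to at least \<open>q |U|\<close>, but
  to hardly more than \<open>p |U|\<close>, so \<open>U\<close> is small.
\<close>

lemma negligible_large_averages:
  fixes f :: "real \<Rightarrow> real"
  assumes f_measurable [measurable]: "f \<in> borel_measurable borel"
    and f: "\<And>x. 0 \<le> f x" "\<And>x. f x \<le> B"
    and pq: "0 \<le> p" "p < q"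
  shows "negligible {x \<in> {-n<..<n}. f x < p \<and> (\<forall>d>0. \<exists>c r. 0 < r \<and> r < d \<and> x \<in> cball c r \<and>
           ennreal (q * (2 * r)) \<le> emeasure (density lborel f) (cball c r))}" (is "negligible ?E")
  \<comment> \<open>The set is not known to be measurable, so it is covered by measurable sets of
    measure at most \<open>e\<close>, for every \<open>e\<close>.\<close>
  unfolding negligible_outer_le
proof (intro allI impI)
  fix e :: real assume e: "0 < e"
  have B: "0 \<le> B" using f[of 0] by linarith
  define \<nu> where "\<nu> = density lborel (\<lambda>x. ennreal (f x))"
  define A where "A = {x. f x < p} \<inter> {-n<..<n}"
  have [measurable]: "A \<in> sets borel" unfolding A_def by measurable
  \<comment> \<open>Chosen so that the final estimate
    \<open>(q - p) * u \<le> B * \<epsilon>\<close> yields \<open>u \<le> e\<close>; the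
    \<open>+ 1\<close> covers \<open>B = 0\<close>.\<close>
  define \<epsilon> where "\<epsilon> = e * (q - p) / (B + 1)"
  have \<epsilon>: "0 < \<epsilon>" using e pq B by (simp add: \<epsilon>_def)
  have "A \<in> sets lebesgue" by (simp add: sets_completionI_sets)
  from sets_lebesgue_outer_open[OF this \<epsilon>] obtain T where
    T: "open T" "A \<subseteq> T" "emeasure lebesgue (T - A) < ennreal \<epsilon>" by metis
  \<comment> \<open>The cut with a bounded interval gives every union of intervals inside
    \<open>G\<close> finite measure, so that \<open>p * u\<close> can be subtracted at the
    end.\<close>
  define G where "G = T \<inter> {-n<..<n}"
  have G: "open G" "A \<subseteq> G" unfolding G_def using T by (auto simp: A_def)
  then have [measurable]: "G \<in> sets borel" by simp
  have "emeasure lborel (G - A) = emeasure lebesgue (G - A)"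
    by (simp add: emeasure_completion)
  also have "\<dots> \<le> emeasure lebesgue (T - A)"
    by (rule emeasure_mono) (use T in \<open>auto simp: G_def intro!: sets_completionI_sets\<close>)
  finally have GA: "emeasure lborel (G - A) < ennreal \<epsilon>" using T by simp
  define K where "K = {(c, r). 0 < r \<and> cball c r \<subseteq> G \<and> ennreal (q * (2 * r)) \<le> emeasure \<nu> (cball c r)}"
  have cover: "\<exists>i. i \<in> K \<and> x \<in> cball (fst i) (snd i) \<and> snd i < d" if x: "x \<in> ?E" and d: "0 < d" for x d
  proof -
    have "x \<in> G" using x G by (auto simp: A_def)
    then obtain \<delta> where \<delta>: "\<delta> > 0" "ball x \<delta> \<subseteq> G" using G(1) open_contains_ball by blast
    \<comment> \<open>The point \<open>x\<close> need not be the centre: a ball of radius below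
      \<open>\<delta>/2\<close> that contains \<open>x\<close> stays in the
      \<open>\<delta>\<close>-ball around \<open>x\<close>.\<close>
    have "0 < min d (\<delta>/2)" using d \<delta> by simp
    with x obtain c r where cr: "0 < r" "r < min d (\<delta>/2)" "x \<in> cball c r"
      "ennreal (q * (2 * r)) \<le> emeasure \<nu> (cball c r)" unfolding \<nu>_def by blast
    have "cball c r \<subseteq> ball x \<delta>"
    proof
      fix y assume "y \<in> cball c r"
      then have "dist c y \<le> r" "dist c x \<le> r" using cr by auto
      then have "dist x y \<le> 2 * r" using dist_triangle3[of x y c] by simp
      then show "y \<in> ball x \<delta>" using cr by simp
    qed
    then have "(c, r) \<in> K" using cr \<delta> by (auto simp: K_def)
    then show ?thesis using cr by (intro exI[of _ "(c, r)"]) auto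
  qed
  have Kpos: "0 < snd i" if "i \<in> K" for i using that by (auto simp: K_def)
  obtain C where C: "countable C" "C \<subseteq> K"
    "pairwise (\<lambda>i j. disjnt (cball (fst i) (snd i)) (cball (fst j) (snd j))) C"
    "negligible (?E - (\<Union>i\<in>C. cball (fst i) (snd i)))"
    by (rule Vitali_covering_theorem_cballs[of K snd ?E fst, OF Kpos cover])
  define I where "I i = cball (fst i) (snd i)" for i :: "real \<times> real"
  define U where "U = (\<Union>i\<in>C. I i)"
  have [measurable]: "I i \<in> sets borel" for i by (simp add: I_def)
  have [measurable]: "U \<in> sets borel" unfolding U_def using C(1) by (intro sets.countable_UN') auto
  have UG: "U \<subseteq> G" using C(2) unfolding U_def I_def K_def by fastforce
  have disj: "disjoint_family_on I C"
    using C(3) by (auto simp: disjoint_family_on_def pairwise_def I_def disjnt_def)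
  have lI: "emeasure lborel (I i) = ennreal (2 * snd i)" if "i \<in> C" for i
    using that C(2) Kpos[of i] by (auto simp: I_def cball_eq_atLeastAtMost)
  have "emeasure lborel U \<le> emeasure lborel {-n<..<n}"
    by (rule emeasure_mono) (use UG in \<open>auto simp: G_def\<close>)
  also have "\<dots> < \<infinity>" by (rule emeasure_bounded_finite) simp
  finally have Ufin: "emeasure lborel U < \<infinity>" .
  define u where "u = measure lborel U"
  have u: "emeasure lborel U = ennreal u" "0 \<le> u"
    using Ufin by (auto simp: u_def emeasure_eq_ennreal_measure)
  have "ennreal q * emeasure lborel U = ennreal q * (\<integral>\<^sup>+i. emeasure lborel (I i) \<partial>count_space C)"
    unfolding U_def using C(1) disj by (subst emeasure_UN_countable) auto
  also have "\<dots> = (\<integral>\<^sup>+i. ennreal q * emeasure lborel (I i) \<partial>count_space C)"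
    by (subst nn_integral_cmult) auto
  also have "\<dots> \<le> (\<integral>\<^sup>+i. emeasure \<nu> (I i) \<partial>count_space C)"
  proof (rule nn_integral_mono)
    fix i assume "i \<in> space (count_space C)"
    then have i: "i \<in> C" by simp
    then have "ennreal (q * (2 * snd i)) \<le> emeasure \<nu> (I i)" "0 < snd i" using C(2) by (auto simp: K_def I_def)
    then show "ennreal q * emeasure lborel (I i) \<le> emeasure \<nu> (I i)"
      using pq by (simp add: lI[OF i] ennreal_mult'[symmetric])
  qed
  also have "\<dots> = emeasure \<nu> U"
    unfolding U_def using C(1) disj by (subst emeasure_UN_countable) (auto simp: \<nu>_def)
  also have "\<dots> = (\<integral>\<^sup>+x. ennreal (f x) * indicator U x \<partial>lborel)"
    unfolding \<nu>_def by (rule emeasure_density) auto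
  also have "\<dots> \<le> (\<integral>\<^sup>+x. ennreal p * indicator U x + ennreal B * indicator (G - A) x \<partial>lborel)"
  proof (rule nn_integral_mono)
    fix x
    show "ennreal (f x) * indicator U x \<le> ennreal p * indicator U x + ennreal B * indicator (G - A) x"
      using f[of x] UG by (cases "x \<in> A"; cases "x \<in> U")
        (auto simp: indicator_def A_def intro!: ennreal_leI add_increasing)
  qed
  also have "\<dots> = ennreal p * emeasure lborel U + ennreal B * emeasure lborel (G - A)"
    by (subst nn_integral_add) (auto simp: nn_integral_cmult)
  also have "\<dots> \<le> ennreal p * emeasure lborel U + ennreal B * ennreal \<epsilon>"
    using GA by (intro add_left_mono mult_left_mono) auto
  finally have "ennreal (q * u) \<le> ennreal (p * u + B * \<epsilon>)"
    using u pq B \<epsilon> by (simp add: ennreal_mult)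
  then have "q * u \<le> p * u + B * \<epsilon>" using u pq B \<epsilon> by (subst (asm) ennreal_le_iff) auto
  then have "(q - p) * u \<le> B * \<epsilon>" by (simp add: algebra_simps)
  also have "B * \<epsilon> \<le> e * (q - p)"
  proof -
    have "B * \<epsilon> = (B / (B + 1)) * (e * (q - p))" using B by (simp add: \<epsilon>_def)
    also have "\<dots> \<le> 1 * (e * (q - p))" by (rule mult_right_mono) (use B e pq in auto)
    finally show ?thesis by simp
  qed
  finally have ue: "u \<le> e" using pq by (simp add: mult.commute)
  \<comment> \<open>The part missed by the Vitali family is null for \<open>lebesgue\<close> but
    need not be Borel, hence the completed measure from here on.\<close>
  have neg: "?E - U \<in> null_sets lebesgue" using C(4) by (simp add: U_def I_def negligible_iff_null_sets)
  have Ul: "U \<in> lmeasurable" using Ufin by (intro fmeasurableI) (auto simp: sets_completionI_sets)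
  show "\<exists>T. ?E \<subseteq> T \<and> T \<in> lmeasurable \<and> measure lebesgue T \<le> e"
  proof (intro exI conjI)
    show "?E \<subseteq> U \<union> (?E - U)" by blast
    show "U \<union> (?E - U) \<in> lmeasurable"
      using Ul neg by (intro fmeasurable.Un) (auto simp: negligible_iff_null_sets[symmetric] negligible_imp_measurable)
    have "measure lebesgue (U \<union> (?E - U)) = measure lebesgue U"
      using Ul neg by (intro measure_Un_null_set) (auto simp: fmeasurableD)
    then show "measure lebesgue (U \<union> (?E - U)) \<le> e" using ue by (simp add: u_def)
  qed
qed

lemma set_integrable_bounded_measurable:
  fixes f :: "real \<Rightarrow> 'b::{banach, second_countable_topology}"
  assumes "f \<in> borel_measurable (restrict_space borel A)" "A \<in> sets borel" "bounded A"
    and "\<And>x. x \<in> A \<Longrightarrow> norm (f x) \<le> B"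
  shows "set_integrable lborel A f"
  unfolding set_integrable_def
proof (rule integrableI_bounded_set[where A = A and B = B])
  show "(\<lambda>x. indicator A x *\<^sub>R f x) \<in> borel_measurable lborel"
    using assms(1,2) by (simp add: borel_measurable_restrict_space_iff)
qed (use assms emeasure_bounded_finite[of A] in auto)

text \<open>A point that violates the estimate has averages of at least \<open>q\<close> on
  arbitrarily short intervals, for rationals \<open>p < q\<close> strictly between
  \<open>f x\<close> and \<open>f x + e\<close>. Rational levels and natural cut-offs
  \<open>n\<close> leave only countably many exceptional sets.\<close>

lemma AE_averages_upper:
  fixes f :: "real \<Rightarrow> real"
  assumes [measurable]: "f \<in> borel_measurable borel"
    and f: "\<And>x. 0 \<le> f x" "\<And>x. f x \<le> B"
  shows "AE x in lborel. \<forall>e>0. \<exists>d>0. \<forall>c r. 0 < r \<and> r < d \<and> x \<in> cball c r \<longrightarrow>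
           (LBINT u:cball c r. f u) \<le> (f x + e) * (2 * r)"
proof -
  define E where "E p q n = {x \<in> {-n<..<n}. f x < p \<and> (\<forall>d>0. \<exists>c r. 0 < r \<and> r < d \<and> x \<in> cball c r \<and>
           ennreal (q * (2 * r)) \<le> emeasure (density lborel f) (cball c r))}" for p q n :: real
  have "AE x in lborel. x \<notin> E p q n" if "0 \<le> p" "p < q" for p q n
  proof -
    have "negligible (E p q n)"
      unfolding E_def by (rule negligible_large_averages[OF assms that])
    then have "E p q n \<in> null_sets lebesgue" by (simp add: negligible_iff_null_sets)
    then have "AE x in lebesgue. x \<notin> E p q n" by (rule AE_not_in)
    then show ?thesis by (simp add: AE_completion_iff)
  qed
  then have "AE x in lborel. \<forall>(p::rat) (q::rat) (n::nat). 0 \<le> p \<and> p < q \<longrightarrow> x \<notin> E (of_rat p) (of_rat q) (of_nat n)"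
    by (intro AE_all_countable[THEN iffD2] allI AE_impI) (auto simp: of_rat_less)
  then show ?thesis
  proof eventually_elim
    case (elim x)
    show ?case
    proof (intro allI impI)
      fix e :: real assume e: "0 < e"
      obtain p where p: "f x < of_rat p" "of_rat p < f x + e" using of_rat_dense[of "f x" "f x + e"] e by auto
      obtain q where q: "of_rat p < (of_rat q :: real)" "of_rat q < f x + e" using of_rat_dense[OF p(2)] by auto
      obtain n :: nat where n: "\<bar>x\<bar> < of_nat n" using reals_Archimedean2 by blast
      have "(0::real) \<le> of_rat p" using f(1)[of x] p(1) by linarith
      then have "0 \<le> p" by simp
      moreover have "p < q" using q by (simp add: of_rat_less)
      ultimately have "x \<notin> E (of_rat p) (of_rat q) (of_nat n)" using elim by blast
      then obtain d where d: "d > 0" "\<And>c r. 0 < r \<Longrightarrow> r < d \<Longrightarrow> x \<in> cball c r \<Longrightarrow>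
          emeasure (density lborel f) (cball c r) < ennreal (of_rat q * (2 * r))"
      proof -
        have "x \<in> {-real n<..<real n}" using n by auto
        then have "\<not> (\<forall>d>0. \<exists>c r. 0 < r \<and> r < d \<and> x \<in> cball c r \<and>
            ennreal (of_rat q * (2 * r)) \<le> emeasure (density lborel f) (cball c r))"
          using \<open>x \<notin> E (of_rat p) (of_rat q) (of_nat n)\<close> p(1) unfolding E_def by blast
        then show ?thesis using that by (meson not_le)
      qed
      show "\<exists>d>0. \<forall>c r. 0 < r \<and> r < d \<and> x \<in> cball c r \<longrightarrow>
           (LBINT u:cball c r. f u) \<le> (f x + e) * (2 * r)"
      proof (intro exI[of _ d] conjI allI impI d(1); elim conjE)
        fix c r assume r: "0 < r" "r < d" "x \<in> cball c r"
        have int: "set_integrable lborel (cball c r) f"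
          by (rule set_integrable_bounded_measurable[where B = B]) (use f in \<open>auto intro: measurable_restrict_space1\<close>)
        have "ennreal (LBINT u:cball c r. f u) = (\<integral>\<^sup>+u. ennreal (indicator (cball c r) u *\<^sub>R f u) \<partial>lborel)"
          unfolding set_lebesgue_integral_def
          by (rule nn_integral_eq_integral[symmetric]) (use int f in \<open>auto simp: set_integrable_def\<close>)
        also have "\<dots> = emeasure (density lborel f) (cball c r)"
          by (subst emeasure_density) (auto intro!: nn_integral_cong simp: indicator_def)
        also have "\<dots> < ennreal (of_rat q * (2 * r))" by (rule d(2)[OF r])
        finally have "(LBINT u:cball c r. f u) < of_rat q * (2 * r)"
          by (subst (asm) ennreal_less_iff) (use f in \<open>auto simp: set_lebesgue_integral_def\<close>)
        also have "\<dots> \<le> (f x + e) * (2 * r)" using q r by (intro mult_right_mono) auto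
        finally show "(LBINT u:cball c r. f u) \<le> (f x + e) * (2 * r)" by simp
      qed
    qed
  qed
qed

text \<open>The upper estimate for nonnegative functions, applied to \<open>f + B\<close> and to
  \<open>B - f\<close>, gives both inequalities. The intervals only have to contain
  \<open>x\<close>; this freedom is needed later for intervals that have \<open>x\<close> as an end
  point.\<close>

theorem lebesgue_differentiation:
  fixes f :: "real \<Rightarrow> real"
  assumes [measurable]: "f \<in> borel_measurable borel" and f: "\<And>x. \<bar>f x\<bar> \<le> B"
  shows "AE x in lborel. \<forall>e>0. \<exists>d>0. \<forall>c r. 0 < r \<and> r < d \<and> x \<in> cball c r \<longrightarrow>
           \<bar>(LBINT u:cball c r. f u) - f x * (2 * r)\<bar> \<le> e * (2 * r)"
proof -
  have fB: "0 \<le> f x + B" "f x + B \<le> 2 * B" "0 \<le> B - f x" "B - f x \<le> 2 * B" for x using f[of x] by auto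
  have int: "set_integrable lborel (cball c r) f" for c r :: real
    by (rule set_integrable_bounded_measurable[where B = B]) (use f in \<open>auto intro: measurable_restrict_space1\<close>)
  have intB: "set_integrable lborel (cball c r) (\<lambda>_. B)" for c r :: real
    by (rule set_integrable_bounded_measurable[where B = "\<bar>B\<bar>"]) auto
  have B: "(LBINT u:cball c r. B) = B * (2 * r)" if "0 < r" for c r :: real
    using that by (simp add: set_integral_const cball_eq_atLeastAtMost measure_def)
  have "AE x in lborel. \<forall>e>0. \<exists>d>0. \<forall>c r. 0 < r \<and> r < d \<and> x \<in> cball c r \<longrightarrow>
           (LBINT u:cball c r. f u + B) \<le> (f x + B + e) * (2 * r)"
    by (rule AE_averages_upper[where B = "2 * B"]) (use fB in auto)
  moreover have "AE x in lborel. \<forall>e>0. \<exists>d>0. \<forall>c r. 0 < r \<and> r < d \<and> x \<in> cball c r \<longrightarrow>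
           (LBINT u:cball c r. B - f u) \<le> (B - f x + e) * (2 * r)"
    by (rule AE_averages_upper[where B = "2 * B"]) (use fB in auto)
  ultimately show ?thesis
  proof eventually_elim
    case (elim x)
    show ?case
    proof (intro allI impI)
      fix e :: real assume e: "0 < e"
      obtain d1 where d1: "d1 > 0" "\<And>c r. 0 < r \<and> r < d1 \<and> x \<in> cball c r \<Longrightarrow>
           (LBINT u:cball c r. f u + B) \<le> (f x + B + e) * (2 * r)"
        using elim(1) e by blast
      obtain d2 where d2: "d2 > 0" "\<And>c r. 0 < r \<and> r < d2 \<and> x \<in> cball c r \<Longrightarrow>
           (LBINT u:cball c r. B - f u) \<le> (B - f x + e) * (2 * r)"
        using elim(2) e by blast
      show "\<exists>d>0. \<forall>c r. 0 < r \<and> r < d \<and> x \<in> cball c r \<longrightarrow>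
           \<bar>(LBINT u:cball c r. f u) - f x * (2 * r)\<bar> \<le> e * (2 * r)"
      proof (intro exI[of _ "min d1 d2"] conjI allI impI; (elim conjE)?)
        fix c r assume r: "0 < r" "r < min d1 d2" "x \<in> cball c r"
        have "(LBINT u:cball c r. f u) + B * (2 * r) \<le> (f x + B + e) * (2 * r)"
          using d1(2)[of r c] r by (simp add: set_integral_add int intB B)
        moreover have "B * (2 * r) - (LBINT u:cball c r. f u) \<le> (B - f x + e) * (2 * r)"
          using d2(2)[of r c] r by (simp add: set_integral_diff int intB B)
        ultimately show "\<bar>(LBINT u:cball c r. f u) - f x * (2 * r)\<bar> \<le> e * (2 * r)"
          by (simp add: algebra_simps abs_le_iff)
      qed (use d1 d2 in auto)
    qed
  qed
qed

text \<open>A difference quotient at \<open>x\<close> is an average of \<open>f\<close> over an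
  interval with \<open>x\<close> as an end point. Such an interval is a ball around its midpoint
  that contains \<open>x\<close>, so differentiation along non-centred balls applies to each
  coordinate.\<close>

lemma AE_has_vector_derivative_indefinite_integral:
  fixes f F :: "real \<Rightarrow> 'b::euclidean_space"
  assumes f: "f \<in> borel_measurable (restrict_space borel {a<..<b})" "\<And>x. x \<in> {a<..<b} \<Longrightarrow> norm (f x) \<le> B"
    and F: "\<And>x y. a < x \<Longrightarrow> x \<le> y \<Longrightarrow> y < b \<Longrightarrow> F y - F x = (LBINT u:{x..y}. f u)"
  shows "AE x in lborel. x \<in> {a<..<b} \<longrightarrow> (F has_vector_derivative f x) (at x)"
proof -
  \<comment> \<open>Extension by zero makes each coordinate a bounded Borel function on the whole
    line; balls inside the interval do not see the change.\<close>
  define g where "g i x = indicator {a<..<b} x * (f x \<bullet> i)" for i x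
  have [measurable]: "g i \<in> borel_measurable borel" for i
  proof -
    have "(\<lambda>x. indicator {a<..<b} x *\<^sub>R (f x)) \<in> borel_measurable borel"
      using f(1) by (subst (asm) borel_measurable_restrict_space_iff) auto
    then have "(\<lambda>x. (indicator {a<..<b} x *\<^sub>R f x) \<bullet> i) \<in> borel_measurable borel" by measurable
    then show ?thesis by (simp add: g_def[abs_def])
  qed
  have gB: "\<bar>g i x\<bar> \<le> \<bar>B\<bar>" if "i \<in> Basis" for i x
    using f(2)[of x] Basis_le_norm[OF that, of "f x"] by (auto simp: g_def indicator_def)
  have "AE x in lborel. \<forall>i\<in>Basis. \<forall>e>0. \<exists>d>0. \<forall>c r. 0 < r \<and> r < d \<and> x \<in> cball c r \<longrightarrow>
           \<bar>(LBINT u:cball c r. g i u) - g i x * (2 * r)\<bar> \<le> e * (2 * r)"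
    by (intro AE_ball_countable[THEN iffD2] ballI lebesgue_differentiation[where B = "\<bar>B\<bar>"]) (auto simp: gB countable_finite)
  then show ?thesis
  proof eventually_elim
    case (elim x)
    show ?case
    proof
      assume x: "x \<in> {a<..<b}"
      have "((\<lambda>x. F x \<bullet> i) has_derivative (\<lambda>h. h *\<^sub>R f x \<bullet> i)) (at x)" if i: "i \<in> Basis" for i
        unfolding has_derivative_at_alt
      proof (intro conjI allI impI)
        show "bounded_linear (\<lambda>h. h *\<^sub>R f x \<bullet> i)"
          by (intro bounded_linear_inner_left_comp bounded_linear_scaleR_left)
        fix e :: real assume e: "0 < e"
        then obtain d where d: "d > 0" "\<And>c r. 0 < r \<Longrightarrow> r < d \<Longrightarrow> x \<in> cball c r \<Longrightarrow>
           \<bar>(LBINT u:cball c r. g i u) - g i x * (2 * r)\<bar> \<le> e * (2 * r)"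
          using bspec[OF elim i] by meson
        \<comment> \<open>Stated for any short interval around \<open>x\<close>, so that the
          increments to the left and to the right of \<open>x\<close> are both instances.\<close>
        have key: "\<bar>F z \<bullet> i - F y \<bullet> i - (z - y) * (f x \<bullet> i)\<bar> \<le> e * (z - y)"
          if yz: "a < y" "y < z" "z < b" "z - y < d" "y \<le> x" "x \<le> z" for y z
        proof -
          define c r where "c = (y + z) / 2" and "r = (z - y) / 2"
          have cr: "c - r = y" "c + r = z" by (auto simp: c_def r_def field_simps)
          then have cb: "cball c r = {y..z}" by (simp add: cball_eq_atLeastAtMost)
          have int: "set_integrable lborel {y..z} f"
            by (rule set_integrable_bounded_measurable[where B = B])
               (use yz f in \<open>auto intro: measurable_restrict_mono[OF f(1)]\<close>)
          have "(LBINT u:cball c r. g i u) = (LBINT u:{y..z}. f u \<bullet> i)"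
            unfolding cb by (rule set_lebesgue_integral_cong) (use yz in \<open>auto simp: g_def\<close>)
          also have "\<dots> = (LBINT u:{y..z}. f u) \<bullet> i"
            using int unfolding set_lebesgue_integral_def set_integrable_def
            by (subst integral_inner_left[symmetric]) auto
          also have "\<dots> = F z \<bullet> i - F y \<bullet> i" using F[of y z] yz by (simp flip: inner_diff_left)
          finally have eq: "(LBINT u:cball c r. g i u) = F z \<bullet> i - F y \<bullet> i" .
          have "\<bar>(LBINT u:cball c r. g i u) - g i x * (2 * r)\<bar> \<le> e * (2 * r)"
            by (rule d(2)) (use yz cb in \<open>auto simp: r_def\<close>)
          moreover have "g i x = f x \<bullet> i" using x by (simp add: g_def)
          moreover have "2 * r = z - y" by (simp add: r_def)
          ultimately show ?thesis unfolding eq by (simp only: mult.commute)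
        qed
        define \<delta> where "\<delta> = min d (min (x - a) (b - x))"
        show "\<exists>d>0. \<forall>y. norm (y - x) < d \<longrightarrow> norm (F y \<bullet> i - F x \<bullet> i - (y - x) *\<^sub>R f x \<bullet> i) \<le> e * norm (y - x)"
        proof (intro exI[of _ \<delta>] conjI allI impI)
          show "0 < \<delta>" using x d by (auto simp: \<delta>_def)
          fix y assume y: "norm (y - x) < \<delta>"
          consider "y = x" | "y < x" | "x < y" by linarith
          then show "norm (F y \<bullet> i - F x \<bullet> i - (y - x) *\<^sub>R f x \<bullet> i) \<le> e * norm (y - x)"
          proof cases
            case 2
            with y have "\<bar>F x \<bullet> i - F y \<bullet> i - (x - y) * (f x \<bullet> i)\<bar> \<le> e * (x - y)"
              by (intro key) (use x in \<open>auto simp: \<delta>_def\<close>)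
            with 2 show ?thesis by (simp add: abs_if algebra_simps split: if_splits)
          next
            case 3
            with y have "\<bar>F y \<bullet> i - F x \<bullet> i - (y - x) * (f x \<bullet> i)\<bar> \<le> e * (y - x)"
              by (intro key) (use x in \<open>auto simp: \<delta>_def\<close>)
            with 3 show ?thesis by simp
          qed simp
        qed
      qed
      then show "(F has_vector_derivative f x) (at x)"
        unfolding has_vector_derivative_def by (subst has_derivative_componentwise_within) auto
    qed
  qed
qed

section \<open>Evolution families with bounded rates\<close>

lemma borel_measurable_vec_iff:
  fixes f :: "'a \<Rightarrow> 'b::euclidean_space^'n"
  shows "f \<in> borel_measurable M \<longleftrightarrow> (\<forall>i. (\<lambda>x. f x $ i) \<in> borel_measurable M)"
proof
  assume f: "f \<in> borel_measurable M"
  have nth: "(\<lambda>v :: 'b^'n. v $ i) \<in> borel_measurable borel" for i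
    by (rule borel_measurable_continuous_onI) (intro continuous_intros)
  show "\<forall>i. (\<lambda>x. f x $ i) \<in> borel_measurable M"
    using measurable_compose[OF f nth] by blast
next
  assume *: "\<forall>i. (\<lambda>x. f x $ i) \<in> borel_measurable M"
  show "f \<in> borel_measurable M"
  proof (rule borel_measurable_euclidean_space[THEN iffD2], rule ballI)
    fix b :: "'b^'n" assume "b \<in> Basis"
    then obtain i u where "b = axis i u" by (auto simp: Basis_vec_def)
    then show "(\<lambda>x. f x \<bullet> b) \<in> borel_measurable M" using * by (auto simp: inner_axis intro: borel_measurable_inner)
  qed
qed

lemma borel_measurable_matrix_vector_mult:
  fixes A :: "'a \<Rightarrow> real^'n^'m"
  assumes "A \<in> borel_measurable M" "f \<in> borel_measurable M"
  shows "(\<lambda>x. A x *v f x) \<in> borel_measurable M"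
  using assms unfolding borel_measurable_vec_iff by (auto simp: matrix_vector_mult_def intro!: borel_measurable_sum borel_measurable_times)

text \<open>The norm of a matrix is here the Euclidean norm of its entries, so Cauchy-Schwarz in
  each row suffices.\<close>

lemma norm_matrix_vector_mult_le: "norm (A *v x) \<le> norm A * norm x" for A :: "real^'n^'m"
proof -
  have "norm (A *v x) \<le> L2_set (\<lambda>i. norm (A $ i) * norm x) UNIV"
    unfolding norm_vec_def[of "A *v x"]
    by (rule L2_set_mono) (auto simp: matrix_vector_mul_component Cauchy_Schwarz_ineq2)
  also have "\<dots> = norm A * norm x"
    unfolding norm_vec_def[of A] by (rule L2_set_left_distrib[symmetric]) simp
  finally show ?thesis .
qed

lemma bounded_linear_matrix_vector_mult_left: "bounded_linear (\<lambda>A. A *v x)" for x :: "real^'n"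
  by (rule bounded_linear_intro[where K = "norm x"])
     (auto simp: matrix_vector_mult_add_rdistrib scaleR_matrix_vector_assoc norm_matrix_vector_mult_le)

section \<open>Integrals over compact intervals, and functions with quadratic increments\<close>

lemma norm_set_integral_Icc_le:
  fixes f :: "real \<Rightarrow> 'b::{banach, second_countable_topology}"
  assumes "set_integrable lborel {a..b} f" "\<And>x. x \<in> {a..b} \<Longrightarrow> norm (f x) \<le> B" "a \<le> b"
  shows "norm (LBINT u:{a..b}. f u) \<le> B * (b - a)"
proof -
  have "norm (LBINT u:{a..b}. f u) \<le> (LBINT u:{a..b}. norm (f u))"
    by (rule set_integral_norm_bound[OF assms(1)])
  also have "\<dots> \<le> (LBINT u:{a..b}. B)"
    by (rule set_integral_mono) (use assms set_integrable_norm[OF assms(1)] in \<open>auto simp: set_integrable_def\<close>)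
  also have "\<dots> = B * (b - a)" using assms(3) by (simp add: set_integral_const)
  finally show ?thesis .
qed

lemma set_integral_singleton:
  fixes f :: "real \<Rightarrow> 'b::{banach, second_countable_topology}"
  shows "(LBINT u:{a}. f u) = 0"
  unfolding set_lebesgue_integral_def
  by (rule integral_eq_zero_AE) (use AE_lborel_singleton[of a] in eventually_elim, auto)

lemma set_integral_Icc_split:
  fixes f :: "real \<Rightarrow> 'b::{banach, second_countable_topology}"
  assumes "set_integrable lborel {a..c} f" "a \<le> b" "b \<le> c"
  shows "(LBINT u:{a..c}. f u) = (LBINT u:{a..b}. f u) + (LBINT u:{b..c}. f u)"
proof -
  have "{a..c} = {a..b} \<union> {b..c}" using assms by auto
  moreover have "(LBINT u:{a..b} \<union> {b..c}. f u) = (LBINT u:{a..b}. f u) + (LBINT u:{b..c}. f u)"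
  proof (rule set_integral_Un_AE)
    show "AE x in lborel. \<not> (x \<in> {a..b} \<and> x \<in> {b..c})"
      using AE_lborel_singleton[of b] by eventually_elim auto
  qed (use assms in \<open>auto intro: set_integrable_subset[OF assms(1)]\<close>)
  ultimately show ?thesis by simp
qed

lemma set_integral_bounded_linear:
  assumes "bounded_linear h" "set_integrable M A f"
  shows "(LINT x:A|M. h (f x)) = h (LINT x:A|M. f x)"
proof -
  interpret bounded_linear h by fact
  show ?thesis
    using integral_bounded_linear[OF assms(1), of M "\<lambda>x. indicator A x *\<^sub>R f x"] assms(2)
    by (simp add: set_lebesgue_integral_def set_integrable_def scaleR)
qed

text \<open>Quadratic increments force derivative zero at every point of the interval, one-sidedly
  at its ends, and a function with zero derivative on a convex set is constant.\<close>

lemma constant_if_quadratic_increments: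
  fixes f :: "real \<Rightarrow> 'b::real_normed_vector"
  assumes "\<And>x y. a \<le> x \<Longrightarrow> x \<le> y \<Longrightarrow> y \<le> b \<Longrightarrow> norm (f x - f y) \<le> C * (y - x)\<^sup>2"
    and "x \<in> {a..b}" "y \<in> {a..b}"
  shows "f x = f y"
proof -
  have C: "norm (f z - f x) \<le> \<bar>C\<bar> * (z - x)\<^sup>2" if "x \<in> {a..b}" "z \<in> {a..b}" for x z
  proof -
    have "norm (f z - f x) \<le> C * (z - x)\<^sup>2"
      using assms(1)[of x z] assms(1)[of z x] that
      by (cases "x \<le> z") (auto simp: norm_minus_commute power2_commute)
    also have "\<dots> \<le> \<bar>C\<bar> * (z - x)\<^sup>2" by (rule mult_right_mono) auto
    finally show ?thesis .
  qed
  have "\<exists>c. \<forall>x\<in>{a..b}. f x = c"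
  proof (rule has_derivative_zero_constant)
    fix x assume x: "x \<in> {a..b}"
    show "(f has_derivative (\<lambda>h. 0)) (at x within {a..b})"
      unfolding has_derivative_within_alt
    proof (intro conjI allI impI)
      fix e :: real assume e: "0 < e"
      show "\<exists>d>0. \<forall>y\<in>{a..b}. norm (y - x) < d \<longrightarrow> norm (f y - f x - 0) \<le> e * norm (y - x)"
      \<comment> \<open>No sign of \<open>C\<close> is assumed, hence the absolute value; this
        radius gives \<open>\<bar>C\<bar> * \<bar>z - x\<bar> \<le> e\<close>.\<close>
      proof (intro exI[of _ "e / (\<bar>C\<bar> + 1)"] conjI ballI impI)
        fix z assume z: "z \<in> {a..b}" "norm (z - x) < e / (\<bar>C\<bar> + 1)"
        have "\<bar>C\<bar> * \<bar>z - x\<bar> \<le> (\<bar>C\<bar> + 1) * \<bar>z - x\<bar>" by (rule mult_right_mono) auto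
        also have "\<dots> \<le> e" using z(2) by (simp add: pos_less_divide_eq mult.commute)
        finally have "\<bar>C\<bar> * \<bar>z - x\<bar> * \<bar>z - x\<bar> \<le> e * \<bar>z - x\<bar>" by (rule mult_right_mono) simp
        moreover have "(z - x)\<^sup>2 = \<bar>z - x\<bar> * \<bar>z - x\<bar>" by (simp add: power2_eq_square)
        ultimately show "norm (f z - f x - 0) \<le> e * norm (z - x)"
          using C[OF x z(1)] by (simp add: mult.assoc)
      qed (use e in auto)
    qed simp
  qed simp
  then show ?thesis using assms by auto
qed

text \<open>Isolates the analytic content of the model: stochasticity of \<open>P\<close> will
  supply \<open>p\<close>, the bounds on the rates will supply \<open>q\<close>, and everything
  below is norm estimates, composition and the integrated forward equation.\<close>

locale bounded_evolution =
  fixes P :: "real \<Rightarrow> real \<Rightarrow> real^'s^'s::finite"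
    and Q :: "real \<Rightarrow> real^'s^'s"
    and p q :: real
  assumes P_bound: "\<And>s t. 0 \<le> s \<Longrightarrow> s \<le> t \<Longrightarrow> norm (P s t) \<le> p"
    and Q_bound: "\<And>t. 0 \<le> t \<Longrightarrow> norm (Q t) \<le> q"
    and Q_measurable: "Q \<in> borel_measurable (restrict_space borel {0..})"
    and composition: "\<And>s u t. 0 \<le> s \<Longrightarrow> s \<le> u \<Longrightarrow> u \<le> t \<Longrightarrow> P s t = P s u ** P u t"
    and forward_integrable: "\<And>s t. 0 \<le> s \<Longrightarrow> s \<le> t \<Longrightarrow> set_integrable lborel {s..t} (\<lambda>u. P s u ** Q u)"
    and forward: "\<And>s t. 0 \<le> s \<Longrightarrow> s \<le> t \<Longrightarrow> P s t = mat 1 + (LBINT u:{s..t}. P s u ** Q u)"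
begin

lemma p_nonneg: "0 \<le> p" and q_nonneg: "0 \<le> q"
  using order_trans[OF norm_ge_zero P_bound[of 0 0]] order_trans[OF norm_ge_zero Q_bound[of 0]] by auto

lemma norm_P_mult_le: "0 \<le> s \<Longrightarrow> s \<le> t \<Longrightarrow> norm (P s t *v x) \<le> p * norm x"
  using norm_matrix_vector_mult_le[of "P s t" x] mult_right_mono[OF P_bound norm_ge_zero[of x], of s t] by linarith

lemma norm_Q_mult_le: "0 \<le> t \<Longrightarrow> norm (Q t *v x) \<le> q * norm x"
  using norm_matrix_vector_mult_le[of "Q t" x] mult_right_mono[OF Q_bound norm_ge_zero[of x], of t] by linarith

lemma P_refl: "0 \<le> s \<Longrightarrow> P s s = mat 1"
  using forward[of s s] by (simp add: set_integral_singleton)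

lemma forward_mult_integrable:
  assumes "0 \<le> s" "s \<le> t"
  shows "set_integrable lborel {s..t} (\<lambda>u. P s u *v (Q u *v x))"
  using integrable_bounded_linear[OF bounded_linear_matrix_vector_mult_left[of x] forward_integrable[OF assms, unfolded set_integrable_def]]
  by (simp add: set_integrable_def scaleR_matrix_vector_assoc matrix_vector_mul_assoc)

lemma forward_mult:
  assumes "0 \<le> s" "s \<le> t"
  shows "P s t *v x = x + (LBINT u:{s..t}. P s u *v (Q u *v x))"
  using set_integral_bounded_linear[OF bounded_linear_matrix_vector_mult_left[of x] forward_integrable[OF assms]]
    forward[OF assms] by (simp add: matrix_vector_mult_add_rdistrib matrix_vector_mul_assoc)

text \<open>The quantitative form of \<open>P s t = I + O(t - s)\<close>, uniform in
  \<open>s\<close>. This is where bounded rates turn the forward equation into an estimate, and all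
  linear and quadratic error terms below come from it.\<close>

lemma norm_P_mult_diff_le:
  assumes "0 \<le> s" "s \<le> t"
  shows "norm (P s t *v x - x) \<le> p * q * norm x * (t - s)"
proof -
  have "norm (LBINT u:{s..t}. P s u *v (Q u *v x)) \<le> (p * q * norm x) * (t - s)"
  proof (rule norm_set_integral_Icc_le[OF forward_mult_integrable[OF assms] _ assms(2)])
    fix u assume "u \<in> {s..t}"
    then have "norm (P s u *v (Q u *v x)) \<le> p * norm (Q u *v x)" "norm (Q u *v x) \<le> q * norm x"
      using assms norm_P_mult_le norm_Q_mult_le by auto
    then show "norm (P s u *v (Q u *v x)) \<le> p * q * norm x"
      using mult_left_mono[of "norm (Q u *v x)" "q * norm x" p] p_nonneg by (simp add: mult.assoc)
  qed
  then show ?thesis by (simp add: forward_mult[OF assms])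
qed

text \<open>\<open>P s\<close> is Lipschitz in the later time, because composition writes its
  increment from \<open>u\<close> to \<open>v\<close> as \<open>P s u\<close> applied to
  \<open>P u v - I\<close>.\<close>

lemma P_measurable:
  assumes "0 \<le> s"
  shows "P s \<in> borel_measurable (restrict_space borel {s..t})"
proof -
  have "(\<lambda>u. P s u $ i $ j) \<in> borel_measurable (restrict_space borel {s..t})" for i j
  proof (rule borel_measurable_continuous_on_restrict)
    define L where "L = p * (p * q * norm (axis j 1 :: real^'s))"
    have *: "\<bar>P s v $ i $ j - P s u $ i $ j\<bar> \<le> L * (v - u)" if "s \<le> u" "u \<le> v" for u v
    proof -
      \<comment> \<open>Entries are read off from the action on basis vectors, so that the estimates
        for vectors apply.\<close>
      have entry: "A $ i $ j = (A *v axis j 1) $ i" for A :: "real^'s^'s"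
        by (simp add: matrix_vector_mult_basis column_def)
      have "P s v $ i $ j - P s u $ i $ j = (P s u *v (P u v *v axis j 1 - axis j 1)) $ i"
        unfolding composition[OF assms that] entry[of "P s u ** P u v"] entry[of "P s u"]
        by (simp only: matrix_vector_mult_diff_distrib matrix_vector_mul_assoc vector_minus_component)
      also have "\<bar>\<dots>\<bar> \<le> norm (P s u *v (P u v *v axis j 1 - axis j 1))"
        using component_le_norm_cart by blast
      also have "\<dots> \<le> p * norm (P u v *v axis j 1 - axis j (1::real))"
        by (rule norm_P_mult_le) (use assms that in auto)
      also have "\<dots> \<le> p * (p * q * norm (axis j 1 :: real^'s) * (v - u))"
        by (intro mult_left_mono norm_P_mult_diff_le p_nonneg) (use assms that in auto)
      finally show ?thesis by (simp add: L_def mult.assoc)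
    qed
    have "(\<bar>L\<bar>)-lipschitz_on {s..t} (\<lambda>u. P s u $ i $ j)"
    proof (rule lipschitz_onI)
      fix u v assume uv: "u \<in> {s..t}" "v \<in> {s..t}"
      have "dist (P s u $ i $ j) (P s v $ i $ j) \<le> L * \<bar>u - v\<bar>"
        using *[of u v] *[of v u] uv by (cases "u \<le> v") (auto simp: dist_real_def)
      also have "\<dots> \<le> \<bar>L\<bar> * dist u v" unfolding dist_real_def by (intro mult_right_mono) auto
      finally show "dist (P s u $ i $ j) (P s v $ i $ j) \<le> \<bar>L\<bar> * dist u v" .
    qed simp
    then show "continuous_on {s..t} (\<lambda>u. P s u $ i $ j)" by (rule lipschitz_on_continuous_on)
  qed
  then show ?thesis by (simp add: borel_measurable_vec_iff)
qed

lemma P_mult_integrable: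
  assumes "0 \<le> s" "f \<in> borel_measurable (restrict_space borel {s..t})" "\<And>u. u \<in> {s..t} \<Longrightarrow> norm (f u) \<le> F"
  shows "set_integrable lborel {s..t} (\<lambda>u. P s u *v f u)"
proof (rule set_integrable_bounded_measurable)
  show "(\<lambda>u. P s u *v f u) \<in> borel_measurable (restrict_space borel {s..t})"
    by (intro borel_measurable_matrix_vector_mult P_measurable assms)
  fix u assume u: "u \<in> {s..t}"
  have "norm (P s u *v f u) \<le> p * norm (f u)" by (rule norm_P_mult_le) (use u assms in auto)
  also have "\<dots> \<le> p * F" by (rule mult_left_mono[OF assms(3)[OF u] p_nonneg])
  finally show "norm (P s u *v f u) \<le> p * F" .
qed auto

text \<open>The variation-of-constants form of the backward equation \<open>- W' = f + Q W\<close>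
  on \<open>[a, b]\<close>. It makes sense before any regularity of \<open>W\<close> is
  known.\<close>

definition evolves :: "(real \<Rightarrow> real^'s) \<Rightarrow> real \<Rightarrow> real \<Rightarrow> (real \<Rightarrow> real^'s) \<Rightarrow> bool" where
  "evolves f a b W \<longleftrightarrow> (\<forall>s s'. a \<le> s \<longrightarrow> s \<le> s' \<longrightarrow> s' \<le> b \<longrightarrow>
     W s = (LBINT u:{s..s'}. P s u *v f u) + P s s' *v W s')"

context
  fixes f W :: "real \<Rightarrow> real^'s" and a b F :: real
  assumes a: "0 \<le> a"
    and f_meas: "f \<in> borel_measurable (restrict_space borel {a..b})"
    and f_bound: "\<And>u. u \<in> {a..b} \<Longrightarrow> norm (f u) \<le> F"
    and W: "evolves f a b W"
begin

lemma restrict_f: "a \<le> s \<Longrightarrow> s' \<le> b \<Longrightarrow> f \<in> borel_measurable (restrict_space borel {s..s'})"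
  using f_meas by (rule measurable_restrict_mono) auto

lemma evolves_bounded_lipschitz:
  obtains w L where "0 \<le> w" "0 \<le> L" "\<And>s. s \<in> {a..b} \<Longrightarrow> norm (W s) \<le> w"
    "\<And>s s'. a \<le> s \<Longrightarrow> s \<le> s' \<Longrightarrow> s' \<le> b \<Longrightarrow> norm (W s - W s') \<le> L * (s' - s)"
proof -
  \<comment> \<open>\<open>w\<close> is read off from \<open>evolves\<close> with
    \<open>s' = b\<close>. In \<open>L\<close>, the first summand bounds the integral of
    \<open>f\<close> and the second bounds \<open>P s s' - I\<close> acting on \<open>W s'\<close>,
    whose norm is at most \<open>w\<close>.\<close>
  define w where "w = p * \<bar>F\<bar> * \<bar>b - a\<bar> + p * norm (W b)"
  define L where "L = p * \<bar>F\<bar> + p * q * w"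
  have w0: "0 \<le> w" and L0: "0 \<le> L" using p_nonneg q_nonneg by (auto simp: w_def L_def)
  have f_int: "norm (LBINT u:{s..s'}. P s u *v f u) \<le> p * \<bar>F\<bar> * (s' - s)" if "a \<le> s" "s \<le> s'" "s' \<le> b" for s s'
  proof (rule norm_set_integral_Icc_le)
    show "set_integrable lborel {s..s'} (\<lambda>u. P s u *v f u)"
      by (rule P_mult_integrable[where F = F]) (use that a f_bound restrict_f in auto)
    fix u assume u: "u \<in> {s..s'}"
    have "norm (P s u *v f u) \<le> p * norm (f u)" by (rule norm_P_mult_le) (use u a that in auto)
    also have "\<dots> \<le> p * \<bar>F\<bar>"
      using f_bound[of u] u that by (intro mult_left_mono p_nonneg) auto
    finally show "norm (P s u *v f u) \<le> p * \<bar>F\<bar>" .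
  qed (use that in auto)
  have bound: "norm (W s) \<le> w" if s: "s \<in> {a..b}" for s
  proof -
    have "norm (W s) \<le> norm (LBINT u:{s..b}. P s u *v f u) + norm (P s b *v W b)"
      using W s by (auto simp: evolves_def intro: norm_triangle_ineq)
    also have "\<dots> \<le> p * \<bar>F\<bar> * (b - s) + p * norm (W b)"
      by (intro add_mono f_int norm_P_mult_le) (use s a in auto)
    also have "p * \<bar>F\<bar> * (b - s) \<le> p * \<bar>F\<bar> * \<bar>b - a\<bar>"
      by (rule mult_left_mono) (use s p_nonneg in auto)
    finally show ?thesis by (simp add: w_def)
  qed
  have "norm (W s - W s') \<le> L * (s' - s)" if s: "a \<le> s" "s \<le> s'" "s' \<le> b" for s s'
  proof -
    have "W s - W s' = (LBINT u:{s..s'}. P s u *v f u) + (P s s' *v W s' - W s')"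
      using W s unfolding evolves_def by (metis add_diff_eq)
    then have "norm (W s - W s') \<le> norm (LBINT u:{s..s'}. P s u *v f u) + norm (P s s' *v W s' - W s')"
      by (metis norm_triangle_ineq)
    also have "\<dots> \<le> p * \<bar>F\<bar> * (s' - s) + p * q * norm (W s') * (s' - s)"
      by (intro add_mono f_int norm_P_mult_diff_le) (use s a in auto)
    also have "p * q * norm (W s') * (s' - s) \<le> p * q * w * (s' - s)"
      by (intro mult_right_mono mult_left_mono bound) (use s p_nonneg q_nonneg in auto)
    finally show ?thesis by (simp add: L_def distrib_right)
  qed
  with that w0 L0 bound show ?thesis by blast
qed

lemma evolves_continuous: "continuous_on {a..b} W"
proof -
  obtain w L where wL: "0 \<le> L" "\<And>s s'. a \<le> s \<Longrightarrow> s \<le> s' \<Longrightarrow> s' \<le> b \<Longrightarrow> norm (W s - W s') \<le> L * (s' - s)"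
    using evolves_bounded_lipschitz by metis
  have "L-lipschitz_on {a..b} W"
  proof (rule lipschitz_onI)
    fix x y assume "x \<in> {a..b}" "y \<in> {a..b}"
    then show "dist (W x) (W y) \<le> L * dist x y"
      using wL(2)[of x y] wL(2)[of y x] by (cases "x \<le> y") (auto simp: dist_norm norm_minus_commute)
  qed fact
  then show ?thesis by (rule lipschitz_on_continuous_on)
qed

lemma evolves_integrand_integrable:
  assumes "a \<le> s" "s' \<le> b"
  shows "set_integrable lborel {s..s'} f" "set_integrable lborel {s..s'} (\<lambda>u. Q u *v W u)"
proof -
  show "set_integrable lborel {s..s'} f"
    by (rule set_integrable_bounded_measurable[where B = F]) (use assms restrict_f f_bound in auto)
  obtain w where w: "\<And>s. s \<in> {a..b} \<Longrightarrow> norm (W s) \<le> w" using evolves_bounded_lipschitz by metis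
  show "set_integrable lborel {s..s'} (\<lambda>u. Q u *v W u)"
  proof (rule set_integrable_bounded_measurable[where B = "q * w"])
    show "(\<lambda>u. Q u *v W u) \<in> borel_measurable (restrict_space borel {s..s'})"
      by (intro borel_measurable_matrix_vector_mult borel_measurable_continuous_on_restrict
            continuous_on_subset[OF evolves_continuous] measurable_restrict_mono[OF Q_measurable]) (use assms a in auto)
    fix u assume "u \<in> {s..s'}"
    then have u: "u \<in> {a..b}" using assms by auto
    have "norm (Q u *v W u) \<le> q * norm (W u)" by (rule norm_Q_mult_le) (use u a in auto)
    also have "\<dots> \<le> q * w" by (rule mult_left_mono[OF w[OF u] q_nonneg])
    finally show "norm (Q u *v W u) \<le> q * w" .
  qed auto
qed

text \<open>
  The defect \<open>D\<close> of the equation has quadratically small increments: over \<open>[x, y]\<close>, replacing \<open>P x u\<close>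
  by the identity and \<open>W y\<close> by \<open>W u\<close> costs \<open>O(y - x)\<close> under an integral of length \<open>y - x\<close>.  Only the
  forward equation is used.
\<close>

lemma evolves_integral_equation:
  assumes s: "s \<in> {a..b}"
  shows "W s = (LBINT u:{s..b}. f u) + (LBINT u:{s..b}. Q u *v W u) + W b"
proof -
  obtain w L where wL: "0 \<le> w" "0 \<le> L" "\<And>s. s \<in> {a..b} \<Longrightarrow> norm (W s) \<le> w"
    "\<And>s s'. a \<le> s \<Longrightarrow> s \<le> s' \<Longrightarrow> s' \<le> b \<Longrightarrow> norm (W s - W s') \<le> L * (s' - s)"
    using evolves_bounded_lipschitz by metis
  define D where "D s = W s - (LBINT u:{s..b}. f u) - (LBINT u:{s..b}. Q u *v W u)" for s
  \<comment> \<open>In this order: the cost of replacing \<open>P x u\<close> by the identity in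
    front of \<open>f u\<close>, the same in front of \<open>Q u *v W y\<close>, and the cost of
    replacing \<open>W y\<close> by \<open>W u\<close> behind \<open>Q u\<close>.\<close>
  define C where "C = p * q * \<bar>F\<bar> + (p * q * (q * w) + q * L)"
  have "D s = D b"
  proof (rule constant_if_quadratic_increments[of a b D C])
    fix x y assume xy: "a \<le> x" "x \<le> y" "y \<le> b"
    have ints: "set_integrable lborel {x..y} f" "set_integrable lborel {x..y} (\<lambda>u. Q u *v W u)"
      "set_integrable lborel {x..y} (\<lambda>u. P x u *v f u)" "set_integrable lborel {x..y} (\<lambda>u. P x u *v (Q u *v W y))"
      using xy a f_bound restrict_f
      by (auto intro!: evolves_integrand_integrable forward_mult_integrable P_mult_integrable[where F = F])
    have splits: "(LBINT u:{x..b}. f u) = (LBINT u:{x..y}. f u) + (LBINT u:{y..b}. f u)"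
      "(LBINT u:{x..b}. Q u *v W u) = (LBINT u:{x..y}. Q u *v W u) + (LBINT u:{y..b}. Q u *v W u)"
      using xy by (auto intro!: set_integral_Icc_split evolves_integrand_integrable)
    have "W x - W y = (LBINT u:{x..y}. P x u *v f u) + (P x y *v W y - W y)"
      using W xy unfolding evolves_def by (metis add_diff_eq)
    \<comment> \<open>The vector \<open>W y\<close> is constant in \<open>u\<close>, so the forward
      equation in the later time applies although the increment of \<open>W\<close> is in the
      earlier one.\<close>
    also have "P x y *v W y - W y = (LBINT u:{x..y}. P x u *v (Q u *v W y))"
      using forward_mult[of x y "W y"] xy a by simp
    finally have "D x - D y = (LBINT u:{x..y}. P x u *v f u) - (LBINT u:{x..y}. f u)
       + ((LBINT u:{x..y}. P x u *v (Q u *v W y)) - (LBINT u:{x..y}. Q u *v W u))"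
      unfolding D_def splits by (simp add: algebra_simps)
    also have "\<dots> = (LBINT u:{x..y}. P x u *v f u - f u) + (LBINT u:{x..y}. P x u *v (Q u *v W y) - Q u *v W u)"
      by (simp add: set_integral_diff ints)
    finally have D: "D x - D y = \<dots>" .
    have 1: "norm (LBINT u:{x..y}. P x u *v f u - f u) \<le> (p * q * \<bar>F\<bar> * (y - x)) * (y - x)"
    proof (rule norm_set_integral_Icc_le)
      fix u assume u: "u \<in> {x..y}"
      have "norm (P x u *v f u - f u) \<le> p * q * norm (f u) * (u - x)"
        by (rule norm_P_mult_diff_le) (use u xy a in auto)
      also have "\<dots> \<le> p * q * \<bar>F\<bar> * (y - x)"
        using f_bound[of u] u xy p_nonneg q_nonneg by (intro mult_mono mult_left_mono) auto
      finally show "norm (P x u *v f u - f u) \<le> p * q * \<bar>F\<bar> * (y - x)" .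
    qed (use xy ints in \<open>auto intro: set_integral_diff\<close>)
    have 2: "norm (LBINT u:{x..y}. P x u *v (Q u *v W y) - Q u *v W u) \<le> ((p * q * (q * w) + q * L) * (y - x)) * (y - x)"
    proof (rule norm_set_integral_Icc_le)
      fix u assume u: "u \<in> {x..y}"
      have "norm (Q u *v W y) \<le> q * w"
        using norm_Q_mult_le[of u "W y"] mult_left_mono[OF wL(3)[of y] q_nonneg] u xy a by auto
      then have "p * q * norm (Q u *v W y) * (u - x) \<le> p * q * (q * w) * (y - x)"
        using u p_nonneg q_nonneg wL(1) by (intro mult_mono mult_left_mono) auto
      then have "norm (P x u *v (Q u *v W y) - Q u *v W y) \<le> p * q * (q * w) * (y - x)"
        using norm_P_mult_diff_le[of x u "Q u *v W y"] u xy a by auto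
      moreover have "norm (Q u *v (W u - W y)) \<le> q * L * (y - x)"
      proof -
        have "norm (Q u *v (W u - W y)) \<le> q * norm (W u - W y)" by (rule norm_Q_mult_le) (use u xy a in auto)
        also have "\<dots> \<le> q * (L * (y - u))" by (intro mult_left_mono wL q_nonneg) (use u xy in auto)
        also have "\<dots> \<le> q * (L * (y - x))" by (intro mult_left_mono wL q_nonneg) (use u xy in auto)
        finally show ?thesis by (simp add: mult.assoc)
      qed
      moreover have eq: "P x u *v (Q u *v W y) - Q u *v W u = (P x u *v (Q u *v W y) - Q u *v W y) - Q u *v (W u - W y)"
        by (simp add: matrix_vector_mult_diff_distrib)
      ultimately have "norm (P x u *v (Q u *v W y) - Q u *v W u) \<le> p * q * (q * w) * (y - x) + q * L * (y - x)"
        unfolding eq by (intro order_trans[OF norm_triangle_ineq4 add_mono])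
      then show "norm (P x u *v (Q u *v W y) - Q u *v W u) \<le> (p * q * (q * w) + q * L) * (y - x)"
        by (simp only: distrib_right)
    qed (use xy ints in \<open>auto intro: set_integral_diff\<close>)
    have "norm (D x - D y) \<le> (p * q * \<bar>F\<bar> * (y - x)) * (y - x) + ((p * q * (q * w) + q * L) * (y - x)) * (y - x)"
      unfolding D using norm_triangle_ineq 1 2 by (meson add_mono order_trans)
    then show "norm (D x - D y) \<le> C * (y - x)\<^sup>2" by (simp add: C_def power2_eq_square algebra_simps)
  qed (use s in auto)
  then show ?thesis by (simp add: D_def set_integral_singleton algebra_simps)
qed

end

text \<open>Common shape of \<open>m\<close>, with \<open>f = r_tilde\<close> and
  \<open>g = h\<close>, and of \<open>v\<close>, with \<open>f = \<phi>\<close> and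
  \<open>g = h_tilde\<close>.\<close>

definition jump_value where
  "jump_value f g \<tau> N t s = (LBINT u:{s..t}. P s u *v f u) +
     (\<Sum>i | i \<le> N \<and> s \<le> \<tau> i \<and> \<tau> i \<le> t. P s (\<tau> i) *v g (\<tau> i))"

text \<open>By composition \<open>P s s'\<close> factors out of everything that happens at or after
  \<open>s'\<close>. The index set \<open>A\<close> is fixed and its times are at least
  \<open>b\<close>, so no term drops out as \<open>s\<close> moves through
  \<open>[a, b]\<close>.\<close>

lemma evolves_integral_plus_sum:
  assumes "0 \<le> a" "b \<le> t" and f: "f \<in> borel_measurable (restrict_space borel {0..t})"
    "\<And>u. u \<in> {0..t} \<Longrightarrow> norm (f u) \<le> F" and A: "\<And>i. i \<in> A \<Longrightarrow> b \<le> \<tau> i"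
  shows "evolves f a b (\<lambda>s. (LBINT u:{s..t}. P s u *v f u) + (\<Sum>i\<in>A. P s (\<tau> i) *v g i))"
  unfolding evolves_def
proof (intro allI impI)
  fix s s' assume s: "a \<le> s" "s \<le> s'" "s' \<le> b"
  have int: "set_integrable lborel {x..t} (\<lambda>u. P x u *v f u)" if "0 \<le> x" for x
    by (rule P_mult_integrable[where F = F])
       (use that f in \<open>auto intro: measurable_restrict_mono[OF f(1)]\<close>)
  have split: "(LBINT u:{s..t}. P s u *v f u) = (LBINT u:{s..s'}. P s u *v f u) + (LBINT u:{s'..t}. P s u *v f u)"
    by (rule set_integral_Icc_split[OF int]) (use s assms(1,2) in auto)
  have "(LBINT u:{s'..t}. P s u *v f u) = (LBINT u:{s'..t}. P s s' *v (P s' u *v f u))"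
  proof (rule set_lebesgue_integral_cong)
    show "\<forall>u. u \<in> {s'..t} \<longrightarrow> P s u *v f u = P s s' *v (P s' u *v f u)"
    proof (intro allI impI)
      fix u assume "u \<in> {s'..t}"
      then have "P s u = P s s' ** P s' u" using s assms(1) by (intro composition) auto
      then show "P s u *v f u = P s s' *v (P s' u *v f u)" by (simp add: matrix_vector_mul_assoc)
    qed
  qed simp
  also have "\<dots> = P s s' *v (LBINT u:{s'..t}. P s' u *v f u)"
    by (rule set_integral_bounded_linear[OF matrix_vector_mul_bounded_linear int]) (use s assms(1) in auto)
  finally have int_eq: "(LBINT u:{s'..t}. P s u *v f u) = P s s' *v (LBINT u:{s'..t}. P s' u *v f u)" .
  have "(\<Sum>i\<in>A. P s (\<tau> i) *v g i) = (\<Sum>i\<in>A. P s s' *v (P s' (\<tau> i) *v g i))"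
  proof (rule sum.cong[OF refl])
    fix i assume "i \<in> A"
    then show "P s (\<tau> i) *v g i = P s s' *v (P s' (\<tau> i) *v g i)"
      using A[of i] s assms(1) by (simp add: matrix_vector_mul_assoc composition[of s s' "\<tau> i"])
  qed
  also have "\<dots> = P s s' *v (\<Sum>i\<in>A. P s' (\<tau> i) *v g i)"
    by (rule linear_sum[OF matrix_vector_mul_linear, symmetric])
  finally have sum_eq: "(\<Sum>i\<in>A. P s (\<tau> i) *v g i) = \<dots>" .
  show "(LBINT u:{s..t}. P s u *v f u) + (\<Sum>i\<in>A. P s (\<tau> i) *v g i) = (LBINT u:{s..s'}. P s u *v f u) +
     P s s' *v ((LBINT u:{s'..t}. P s' u *v f u) + (\<Sum>i\<in>A. P s' (\<tau> i) *v g i))"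
    unfolding split int_eq sum_eq by (simp add: matrix_vector_right_distrib add.assoc)
qed

end

section \<open>Value functions with jumps at finitely many times\<close>

locale jump_evolution = bounded_evolution P Q p q
  for P :: "real \<Rightarrow> real \<Rightarrow> real^'s^'s::finite" and Q :: "real \<Rightarrow> real^'s^'s" and p q :: real +
  fixes f g :: "real \<Rightarrow> real^'s" and \<tau> :: "nat \<Rightarrow> real" and N :: nat and t F :: real
  assumes start: "\<tau> 0 = 0" and finish: "\<tau> N = t"
    and mono: "\<And>i j. i \<le> j \<Longrightarrow> j \<le> N \<Longrightarrow> \<tau> i \<le> \<tau> j"
    and strict: "\<And>i j. i < j \<Longrightarrow> j \<le> N \<Longrightarrow> \<tau> i < t \<Longrightarrow> \<tau> i < \<tau> j"
    and f_measurable: "f \<in> borel_measurable (restrict_space borel {0..t})"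
    and f_bound: "\<And>u. u \<in> {0..t} \<Longrightarrow> norm (f u) \<le> F"
begin

abbreviation w where "w \<equiv> jump_value f g \<tau> N t"

text \<open>The value function without the jump at the left end point of \<open>[\<tau> (i - 1), \<tau> i]\<close>, hence continuous there.\<close>

definition piece where
  "piece i s = (LBINT u:{s..t}. P s u *v f u) + (\<Sum>j | j \<le> N \<and> \<tau> i \<le> \<tau> j. P s (\<tau> j) *v g (\<tau> j))"

lemma tau_in: "i \<le> N \<Longrightarrow> \<tau> i \<in> {0..t}"
  using mono[of 0 i] mono[of i N] start finish by auto

text \<open>For \<open>i = 0\<close> truncated subtraction makes the interval the single point
  \<open>\<tau> 0\<close>, so this case needs no separate treatment.\<close>

lemma piece_evolves:
  assumes "i \<le> N"
  shows "evolves f (\<tau> (i - 1)) (\<tau> i) (piece i)"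
  unfolding piece_def[abs_def]
  by (rule evolves_integral_plus_sum[where F = F])
     (use assms tau_in[of i] tau_in[of "i - 1"] f_measurable f_bound in auto)

lemma f_piece:
  assumes "i \<le> N"
  shows "0 \<le> \<tau> (i - 1)" "f \<in> borel_measurable (restrict_space borel {\<tau> (i - 1)..\<tau> i})"
    "\<And>u. u \<in> {\<tau> (i - 1)..\<tau> i} \<Longrightarrow> norm (f u) \<le> F"
proof -
  have "0 \<le> \<tau> (i - 1)" "\<tau> i \<le> t" using tau_in[of "i - 1"] tau_in[of i] assms by auto
  then show "0 \<le> \<tau> (i - 1)" "f \<in> borel_measurable (restrict_space borel {\<tau> (i - 1)..\<tau> i})"
    "\<And>u. u \<in> {\<tau> (i - 1)..\<tau> i} \<Longrightarrow> norm (f u) \<le> F"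
    using f_bound by (auto intro: measurable_restrict_mono[OF f_measurable])
qed

lemmas piece_facts = f_piece piece_evolves

text \<open>Strictly after \<open>\<tau> (i - 1)\<close> the terms still ahead are exactly those
  with time at least \<open>\<tau> i\<close>. The interval is open on the left because at
  \<open>\<tau> (i - 1)\<close> itself one more term counts.\<close>

lemma value_eq_piece:
  assumes i: "1 \<le> i" "i \<le> N" and s: "\<tau> (i - 1) < s" "s \<le> \<tau> i"
  shows "w s = piece i s"
proof -
  have "{j. j \<le> N \<and> s \<le> \<tau> j \<and> \<tau> j \<le> t} = {j. j \<le> N \<and> \<tau> i \<le> \<tau> j}"
  proof (safe)
    fix j assume j: "j \<le> N" "s \<le> \<tau> j" "\<tau> j \<le> t"
    have "i \<le> j"
    proof (rule ccontr)
      assume "\<not> i \<le> j"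
      then have "\<tau> j \<le> \<tau> (i - 1)" using i by (intro mono) auto
      then show False using j s by simp
    qed
    then show "\<tau> i \<le> \<tau> j" using mono j by auto
  next
    fix j assume "j \<le> N" "\<tau> i \<le> \<tau> j"
    then show "s \<le> \<tau> j" "\<tau> j \<le> t" using s tau_in[of j] by auto
  qed
  then show ?thesis by (simp add: jump_value_def piece_def)
qed

text \<open>The additional term is \<open>g\<close> itself, as \<open>P\<close> is the identity at
  equal times. Below \<open>t\<close> the times are strictly increasing, so exactly one index is
  added; at \<open>t\<close> two indices may share the same time.\<close>

lemma value_at_jump:
  assumes i: "1 \<le> i" "i \<le> N" and less: "\<tau> (i - 1) < t"
  shows "w (\<tau> (i - 1)) = g (\<tau> (i - 1)) + piece i (\<tau> (i - 1))"
proof -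
  have "{j. j \<le> N \<and> \<tau> (i - 1) \<le> \<tau> j \<and> \<tau> j \<le> t} = insert (i - 1) {j. j \<le> N \<and> \<tau> i \<le> \<tau> j}"
  proof (intro equalityI subsetI)
    fix j assume "j \<in> {j. j \<le> N \<and> \<tau> (i - 1) \<le> \<tau> j \<and> \<tau> j \<le> t}"
    then have j: "j \<le> N" "\<tau> (i - 1) \<le> \<tau> j" by auto
    consider "j < i - 1" | "j = i - 1" | "i \<le> j" using i by linarith
    then show "j \<in> insert (i - 1) {j. j \<le> N \<and> \<tau> i \<le> \<tau> j}"
    proof cases
      case 1
      then have "\<tau> j \<le> \<tau> (i - 1)" using i by (intro mono) auto
      then have "\<tau> j < \<tau> (i - 1)" using 1 i less by (intro strict) auto
      with j show ?thesis by simp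
    qed (use j mono in auto)
  next
    fix j assume "j \<in> insert (i - 1) {j. j \<le> N \<and> \<tau> i \<le> \<tau> j}"
    moreover have "\<tau> (i - 1) \<le> \<tau> i" "i - 1 \<le> N" using i by (auto intro: mono)
    ultimately show "j \<in> {j. j \<le> N \<and> \<tau> (i - 1) \<le> \<tau> j \<and> \<tau> j \<le> t}"
      using tau_in[of j] by auto
  qed
  moreover have "i - 1 \<notin> {j. j \<le> N \<and> \<tau> i \<le> \<tau> j}" using strict[of "i - 1" i] i less by auto
  ultimately show ?thesis
    using i tau_in[of "i - 1"] by (simp add: jump_value_def piece_def P_refl)
qed

lemma value_at_end:
  assumes "g t = 0"
  shows "w t = 0"
  using tau_in[of N] finish assms
  by (auto simp: jump_value_def set_integral_singleton intro!: sum.neutral dest: antisym)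

lemma piece_continuous: "i \<le> N \<Longrightarrow> continuous_on {\<tau> (i - 1)..\<tau> i} (piece i)"
  by (rule evolves_continuous[OF piece_facts])

lemma value_integral_equation:
  assumes i: "1 \<le> i" "i \<le> N" and s: "\<tau> (i - 1) < s" "s \<le> \<tau> i"
  shows "w s = (LBINT u:{s..\<tau> i}. f u) + (LBINT u:{s..\<tau> i}. Q u *v w u) + w (\<tau> i)"
proof -
  have "piece i s = (LBINT u:{s..\<tau> i}. f u) + (LBINT u:{s..\<tau> i}. Q u *v piece i u) + piece i (\<tau> i)"
    by (rule evolves_integral_equation[OF piece_facts]) (use i s in auto)
  also have "(LBINT u:{s..\<tau> i}. Q u *v piece i u) = (LBINT u:{s..\<tau> i}. Q u *v w u)"
    by (rule set_lebesgue_integral_cong) (use i s value_eq_piece in auto)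
  finally show ?thesis using value_eq_piece[OF i] s by simp
qed

lemma value_right_limit:
  assumes i: "i < N" and less: "\<tau> i < t"
  obtains l where "(w \<longlongrightarrow> l) (at_right (\<tau> i))" "w (\<tau> i) = g (\<tau> i) + l"
proof
  have lt: "\<tau> i < \<tau> (Suc i)" using strict i less by auto
  \<comment> \<open>The right limit is the value of the next piece at its left end, where that piece
    is continuous.\<close>
  have "(piece (Suc i) \<longlongrightarrow> piece (Suc i) (\<tau> i)) (at_right (\<tau> i))"
    using piece_continuous[of "Suc i"] i lt
    by (simp add: continuous_on_Icc_at_rightD)
  moreover have "eventually (\<lambda>s. piece (Suc i) s = w s) (at_right (\<tau> i))"
    using eventually_at_right_real[OF lt] by eventually_elim (use i value_eq_piece[of "Suc i"] in auto)
  ultimately show "(w \<longlongrightarrow> piece (Suc i) (\<tau> i)) (at_right (\<tau> i))"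
    by (rule Lim_transform_eventually)
  show "w (\<tau> i) = g (\<tau> i) + piece (Suc i) (\<tau> i)"
    using value_at_jump[of "Suc i"] i less by simp
qed

lemma Icc_subset_pieces: "{0..t} \<subseteq> insert 0 (\<Union>i\<in>{1..N}. {\<tau> (i - 1)<..\<tau> i})"
proof
  fix s assume s: "s \<in> {0..t}"
  show "s \<in> insert 0 (\<Union>i\<in>{1..N}. {\<tau> (i - 1)<..\<tau> i})"
  proof (cases "s = 0")
    case False
    \<comment> \<open>Minimality gives the strict inequality on the left; \<open>s > 0\<close>
      excludes \<open>i = 0\<close>, for which \<open>i - 1\<close> would not be a smaller
      index.\<close>
    define i where "i = (LEAST i. s \<le> \<tau> i)"
    have i: "s \<le> \<tau> i" unfolding i_def by (rule LeastI[of _ N]) (use s finish in auto)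
    have "i \<le> N" unfolding i_def by (rule Least_le) (use s finish in auto)
    moreover have "i \<noteq> 0" using i start s False by (intro notI) auto
    moreover have "\<not> s \<le> \<tau> (i - 1)" using not_less_Least[of "i - 1" "\<lambda>i. s \<le> \<tau> i"] \<open>i \<noteq> 0\<close> unfolding i_def by simp
    ultimately show ?thesis using i by (auto intro!: bexI[of _ i])
  qed simp
qed

text \<open>Continuity on each of finitely many Borel pieces. Applied to \<open>m\<close>, this is
  what makes \<open>\<phi>\<close> measurable.\<close>

lemma value_measurable: "w \<in> borel_measurable (restrict_space borel {0..t})"
proof (rule measurable_piecewise_restrict[where C = "insert {0} ((\<lambda>i. {\<tau> (i - 1)<..\<tau> i}) ` {1..N})"])
  show "space (restrict_space borel {0..t}) \<subseteq> \<Union> (insert {0} ((\<lambda>i. {\<tau> (i - 1)<..\<tau> i}) ` {1..N}))"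
    using Icc_subset_pieces by (auto simp: space_restrict_space)
  fix \<Omega> assume \<Omega>: "\<Omega> \<in> insert {0} ((\<lambda>i. {\<tau> (i - 1)<..\<tau> i}) ` {1..N})"
  then have \<Omega>_sets: "\<Omega> \<in> sets borel" by auto
  then show "\<Omega> \<inter> space (restrict_space borel {0..t}) \<in> sets (restrict_space borel {0..t})"
    by (simp add: space_restrict_space sets_restrict_space_iff)
  have "w \<in> borel_measurable (restrict_space borel \<Omega>)"
  proof (rule borel_measurable_continuous_on_restrict)
    from \<Omega> consider "\<Omega> = {0}" | i where "i \<in> {1..N}" "\<Omega> = {\<tau> (i - 1)<..\<tau> i}" by auto
    then show "continuous_on \<Omega> w"
    proof cases
      case 2
      have "continuous_on \<Omega> (piece i)"
        by (rule continuous_on_subset[OF piece_continuous]) (use 2 in auto)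
      then show ?thesis
        by (rule continuous_on_eq) (use 2 value_eq_piece in auto)
    qed simp
  qed
  then have "w \<in> borel_measurable (restrict_space borel ({0..t} \<inter> \<Omega>))"
    by (rule measurable_restrict_mono) simp
  moreover have "restrict_space (restrict_space borel {0..t}) \<Omega> = restrict_space borel ({0..t} \<inter> \<Omega>)"
    by (rule restrict_restrict_space) (use \<Omega>_sets in auto)
  ultimately show "w \<in> borel_measurable (restrict_space (restrict_space borel {0..t}) \<Omega>)"
    by (simp only:)
qed simp

lemma value_bounded:
  obtains B where "\<And>s. s \<in> {0..t} \<Longrightarrow> norm (w s) \<le> B"
proof -
  have "\<exists>B. \<forall>s\<in>{\<tau> (i - 1)<..\<tau> i}. norm (w s) \<le> B" if i: "i \<in> {1..N}" for i
  proof -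
    obtain B where "\<And>s. s \<in> {\<tau> (i - 1)..\<tau> i} \<Longrightarrow> norm (piece i s) \<le> B"
      using evolves_bounded_lipschitz[OF piece_facts[of i]] i by (metis atLeastAtMost_iff)
    then show ?thesis using i value_eq_piece[of i] by (intro exI[of _ B]) auto
  qed
  then obtain B where B: "\<And>i s. i \<in> {1..N} \<Longrightarrow> s \<in> {\<tau> (i - 1)<..\<tau> i} \<Longrightarrow> norm (w s) \<le> B i" by metis
  show ?thesis
  proof (rule that)
    fix s assume "s \<in> {0..t}"
    then consider "s = 0" | i where "i \<in> {1..N}" "s \<in> {\<tau> (i - 1)<..\<tau> i}" using Icc_subset_pieces by blast
    then show "norm (w s) \<le> Max (insert (norm (w 0)) (B ` {1..N}))"
    proof cases
      case 2
      then have "norm (w s) \<le> B i" "B i \<in> insert (norm (w 0)) (B ` {1..N})" using B by auto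
      then show ?thesis by (meson Max_ge finite.insertI finite_atLeastAtMost finite_imageI order_trans)
    qed (auto intro: Max_ge)
  qed
qed

text \<open>The integral equation exhibits the piece as an indefinite integral; the minus sign
  arises because \<open>s\<close> is the lower limit. On the open interval the piece and
  \<open>w\<close> agree near each point, so the derivative carries over.\<close>

lemma value_has_derivative_AE:
  assumes i: "1 \<le> i" "i \<le> N"
  shows "AE s in lborel. s \<in> {\<tau> (i - 1)<..<\<tau> i} \<longrightarrow> (w has_vector_derivative - (f s + Q s *v w s)) (at s)"
proof -
  note int = evolves_integrand_integrable[OF piece_facts[OF i(2)]]
  let ?h = "\<lambda>s. - (f s + Q s *v piece i s)"
  obtain B where B: "\<And>s. s \<in> {\<tau> (i - 1)..\<tau> i} \<Longrightarrow> norm (piece i s) \<le> B"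
    using evolves_bounded_lipschitz[OF piece_facts[OF i(2)]] by metis
  have "AE s in lborel. s \<in> {\<tau> (i - 1)<..<\<tau> i} \<longrightarrow> (piece i has_vector_derivative ?h s) (at s)"
  proof (rule AE_has_vector_derivative_indefinite_integral)
    have "(\<lambda>s. f s + Q s *v piece i s) \<in> borel_measurable (restrict_space borel {\<tau> (i - 1)<..<\<tau> i})"
      by (intro borel_measurable_add borel_measurable_matrix_vector_mult borel_measurable_continuous_on_restrict
            continuous_on_subset[OF piece_continuous] measurable_restrict_mono[OF Q_measurable]
            measurable_restrict_mono[OF f_measurable]) (use i f_piece[OF i(2)] tau_in[OF i(2)] in auto)
    then show "?h \<in> borel_measurable (restrict_space borel {\<tau> (i - 1)<..<\<tau> i})"
      by (rule borel_measurable_uminus)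
    fix s assume s: "s \<in> {\<tau> (i - 1)<..<\<tau> i}"
    have "norm (Q s *v piece i s) \<le> q * B"
      using norm_Q_mult_le[of s "piece i s"] mult_left_mono[OF B[of s] q_nonneg] s f_piece(1)[OF i(2)] by auto
    then have "norm (f s + Q s *v piece i s) \<le> F + q * B"
      using norm_triangle_ineq[of "f s" "Q s *v piece i s"] f_piece(3)[OF i(2), of s] s by auto
    then show "norm (?h s) \<le> F + q * B" by (simp only: norm_minus_cancel)
  next
    fix x y assume xy: "\<tau> (i - 1) < x" "x \<le> y" "y < \<tau> i"
    have eq: "piece i s = (LBINT u:{s..\<tau> i}. f u + Q u *v piece i u) + piece i (\<tau> i)" if "s \<in> {\<tau> (i - 1)..\<tau> i}" for s
      using evolves_integral_equation[OF piece_facts[OF i(2)] that] that int[of s "\<tau> i"] by (simp add: set_integral_add)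
    have "set_integrable lborel {x..\<tau> i} (\<lambda>u. f u + Q u *v piece i u)"
      using int[of x "\<tau> i"] xy by (auto intro: set_integral_add)
    from set_integral_Icc_split[OF this xy(2)] xy
    have "piece i y - piece i x = - (LBINT u:{x..y}. f u + Q u *v piece i u)"
      using eq[of x] eq[of y] by simp
    also have "\<dots> = (LBINT u:{x..y}. ?h u)"
      by (simp add: set_lebesgue_integral_def del: minus_add_distrib)
    finally show "piece i y - piece i x = (LBINT u:{x..y}. ?h u)" .
  qed
  then show ?thesis
  proof eventually_elim
    case (elim s)
    show ?case
    proof
      assume s: "s \<in> {\<tau> (i - 1)<..<\<tau> i}"
      with elim have "(piece i has_vector_derivative ?h s) (at s)" by blast
      moreover have eq: "piece i u = w u" if "u \<in> {\<tau> (i - 1)<..<\<tau> i}" for u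
        using value_eq_piece[OF i] that by auto
      ultimately show "(w has_vector_derivative - (f s + Q s *v w s)) (at s)"
        using has_vector_derivative_transform_within_open[of "piece i" _ s "{\<tau> (i - 1)<..<\<tau> i}" w] s by simp
    qed
  qed
qed

text \<open>Finitely many intervals contribute a null set each, and the finitely many times
  \<open>\<tau> i\<close>, among them both end points, are discarded as well.\<close>

lemma value_differentiable_AE: "AE s in lborel. s \<in> {0..t} \<longrightarrow> w differentiable (at s)"
proof -
  have "AE s in lborel. \<forall>i\<in>{1..N}. s \<in> {\<tau> (i - 1)<..<\<tau> i} \<longrightarrow> (w has_vector_derivative - (f s + Q s *v w s)) (at s)"
    by (intro AE_ball_countable[THEN iffD2] ballI value_has_derivative_AE) auto
  moreover have "AE s in lborel. \<forall>i\<in>{0..N}. s \<noteq> \<tau> i"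
    by (intro AE_ball_countable[THEN iffD2] ballI AE_lborel_singleton) auto
  ultimately show ?thesis
  proof eventually_elim
    case (elim s)
    show ?case
    proof
      assume "s \<in> {0..t}"
      moreover have "s \<noteq> 0" using elim(2) start by force
      ultimately obtain i where i: "i \<in> {1..N}" "s \<in> {\<tau> (i - 1)<..\<tau> i}" using Icc_subset_pieces by blast
      moreover have "s \<noteq> \<tau> i" using elim(2) i by auto
      ultimately show "w differentiable (at s)"
        using elim(1) by (auto intro!: differentiableI_vector dest!: bspec[of _ _ i])
    qed
  qed
qed

lemma reversed_value_has_derivative_AE:
  assumes i: "1 \<le> i" "i \<le> N"
  shows "AE s in lborel. 0 \<le> s \<and> s < \<tau> i - \<tau> (i - 1) \<longrightarrow>
    ((\<lambda>s. w (\<tau> i - s)) has_vector_derivative f (\<tau> i - s) + Q (\<tau> i - s) *v w (\<tau> i - s)) (at s)"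
proof -
  \<comment> \<open>An explicit Borel null set is extracted because it can be pulled back under the
    reflection, whereas differentiability itself is not known to be a measurable predicate.\<close>
  from value_has_derivative_AE[OF i] obtain Z where Z: "Z \<in> null_sets lborel"
    "\<And>s. s \<notin> Z \<Longrightarrow> s \<in> {\<tau> (i - 1)<..<\<tau> i} \<Longrightarrow> (w has_vector_derivative - (f s + Q s *v w s)) (at s)"
  proof (rule AE_E3)
    fix Z
    assume "\<And>s. s \<in> space lborel - Z \<Longrightarrow>
        s \<in> {\<tau> (i - 1)<..<\<tau> i} \<longrightarrow> (w has_vector_derivative - (f s + Q s *v w s)) (at s)"
      and "Z \<in> null_sets lborel"
    then show thesis by (intro that) auto
  qed
  have "AE s in lborel. \<tau> i + (-1) * s \<notin> Z"
    by (rule AE_borel_affine) (use Z(1) AE_not_in[OF Z(1)] in auto)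
  \<comment> \<open>\<open>s = 0\<close> corresponds to \<open>\<tau> i\<close>, where
    \<open>w\<close> may jump and the open interval ends.\<close>
  moreover have "AE s in lborel. s \<noteq> 0" by (rule AE_lborel_singleton)
  ultimately show ?thesis
  proof eventually_elim
    case (elim s)
    show ?case
    proof
      assume s: "0 \<le> s \<and> s < \<tau> i - \<tau> (i - 1)"
      let ?D = "- (f (\<tau> i - s) + Q (\<tau> i - s) *v w (\<tau> i - s))"
      have "(w has_vector_derivative ?D) (at (\<tau> i - s))"
        by (rule Z(2)) (use elim s in auto)
      moreover have "((\<lambda>s. \<tau> i - s) has_vector_derivative - 1) (at s)"
        by (auto intro!: derivative_eq_intros)
      ultimately have "((w \<circ> (\<lambda>s. \<tau> i - s)) has_vector_derivative (- 1) *\<^sub>R ?D) (at s)"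
        by (intro vector_diff_chain_at)
      then show "((\<lambda>s. w (\<tau> i - s)) has_vector_derivative f (\<tau> i - s) + Q (\<tau> i - s) *v w (\<tau> i - s)) (at s)"
        by (simp add: o_def add.commute)
    qed
  qed
qed

end

section \<open>Bounded measurable functions and moments\<close>

text \<open>The two properties are bundled because together they pass through sums and products, so
  that they can be read off from the formulas for \<open>r_tilde\<close> and
  \<open>\<phi>\<close>.\<close>

definition bounded_measurable_on :: "real set \<Rightarrow> (real \<Rightarrow> 'b::euclidean_space) \<Rightarrow> bool" where
  "bounded_measurable_on A f \<longleftrightarrow>
     f \<in> borel_measurable (restrict_space borel A) \<and> (\<exists>B. \<forall>u\<in>A. norm (f u) \<le> B)"

lemma bounded_measurable_on_const: "bounded_measurable_on A (\<lambda>_. c)"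
  by (auto simp: bounded_measurable_on_def)

lemma bounded_measurable_on_add:
  assumes "bounded_measurable_on A f" "bounded_measurable_on A g"
  shows "bounded_measurable_on A (\<lambda>u. f u + g u)"
proof -
  obtain B C where "\<forall>u\<in>A. norm (f u) \<le> B" "\<forall>u\<in>A. norm (g u) \<le> C"
    using assms by (auto simp: bounded_measurable_on_def)
  then have "\<forall>u\<in>A. norm (f u + g u) \<le> B + C" by (meson add_mono norm_triangle_le)
  then show ?thesis using assms by (auto simp: bounded_measurable_on_def intro: borel_measurable_add)
qed

lemma bounded_measurable_on_mult:
  fixes f g :: "real \<Rightarrow> real"
  assumes "bounded_measurable_on A f" "bounded_measurable_on A g"
  shows "bounded_measurable_on A (\<lambda>u. f u * g u)"
proof -
  obtain B C where BC: "\<forall>u\<in>A. norm (f u) \<le> B" "\<forall>u\<in>A. norm (g u) \<le> C"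
    using assms by (auto simp: bounded_measurable_on_def)
  have "norm (f u * g u) \<le> B * C" if "u \<in> A" for u
    unfolding norm_mult by (intro mult_mono) (use BC that order_trans[OF norm_ge_zero] in auto)
  then show ?thesis using assms by (auto simp: bounded_measurable_on_def intro: borel_measurable_times)
qed

lemma bounded_measurable_on_sum:
  assumes "\<And>i. i \<in> I \<Longrightarrow> bounded_measurable_on A (f i)"
  shows "bounded_measurable_on A (\<lambda>u. \<Sum>i\<in>I. f i u)"
  using assms
proof (induction I rule: infinite_finite_induct)
  case (insert i I)
  then show ?case by (simp add: bounded_measurable_on_add)
qed (auto simp: bounded_measurable_on_const)

lemma bounded_measurable_on_subset:
  "bounded_measurable_on A f \<Longrightarrow> A' \<subseteq> A \<Longrightarrow> bounded_measurable_on A' f"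
  unfolding bounded_measurable_on_def by (meson measurable_restrict_mono subsetD)

lemma bounded_measurable_on_vec_iff:
  fixes f :: "real \<Rightarrow> 'b::euclidean_space^'n"
  shows "bounded_measurable_on A f \<longleftrightarrow> (\<forall>i. bounded_measurable_on A (\<lambda>u. f u $ i))"
proof
  assume *: "bounded_measurable_on A f"
  then obtain B where "\<forall>u\<in>A. norm (f u) \<le> B" by (auto simp: bounded_measurable_on_def)
  then have "\<forall>u\<in>A. norm (f u $ i) \<le> B" for i by (meson Finite_Cartesian_Product.norm_nth_le order_trans)
  with * show "\<forall>i. bounded_measurable_on A (\<lambda>u. f u $ i)"
    by (auto simp: bounded_measurable_on_def borel_measurable_vec_iff)
next
  assume *: "\<forall>i. bounded_measurable_on A (\<lambda>u. f u $ i)"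
  then have "\<forall>i. \<exists>B. \<forall>u\<in>A. norm (f u $ i) \<le> B" by (auto simp: bounded_measurable_on_def)
  then obtain B where B: "\<And>i u. u \<in> A \<Longrightarrow> norm (f u $ i) \<le> B i" by metis
  have "norm (f u) \<le> (\<Sum>i\<in>UNIV. B i)" if "u \<in> A" for u
  proof -
    have "norm (f u) \<le> (\<Sum>i\<in>UNIV. norm (f u $ i))" unfolding norm_vec_def by (rule L2_set_le_sum) simp
    also have "\<dots> \<le> (\<Sum>i\<in>UNIV. B i)" by (rule sum_mono) (rule B[OF that])
    finally show ?thesis .
  qed
  with * show "bounded_measurable_on A f"
    by (auto simp: bounded_measurable_on_def borel_measurable_vec_iff)
qed

lemmas bounded_measurable_on_intros = bounded_measurable_on_const bounded_measurable_on_add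
  bounded_measurable_on_mult bounded_measurable_on_sum

section \<open>Moments of distribution functions\<close>

lemma distribution_function_interval_measure:
  assumes "distribution_function F"
  shows "real_distribution (interval_measure F)" "cdf (interval_measure F) = F"
proof -
  have F: "\<And>x y. x \<le> y \<Longrightarrow> F x \<le> F y" "\<And>a. continuous (at_right a) F"
    "(F \<longlongrightarrow> 0) at_bot" "(F \<longlongrightarrow> 1) at_top"
    using assms by (auto simp: distribution_function_def mono_def)
  show "real_distribution (interval_measure F)" by (rule real_distribution_interval_measure[OF F])
  show "cdf (interval_measure F) = F" by (rule cdf_interval_measure[OF F(1-3)])
qed

lemma distribution_function_nonneg:
  assumes "distribution_function F"
  shows "0 \<le> F z"
  using distribution_function_interval_measure(2)[OF assms] by (metis cdf_def measure_nonneg)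

text \<open>\<open>1 \<le> F c\<close> puts all mass on \<open>{..c}\<close>, and the integral only
  sees \<open>{0..}\<close>, where then \<open>z ^ k \<le> \<bar>c\<bar> ^ k\<close>.\<close>

lemma abs_moment_le:
  assumes F: "distribution_function F" and c: "1 \<le> F c"
  shows "\<bar>moment k F\<bar> \<le> \<bar>c\<bar> ^ k"
proof -
  interpret real_distribution "interval_measure F" by (rule distribution_function_interval_measure[OF F])
  have "prob {..c} = F c" using distribution_function_interval_measure(2)[OF F] by (metis cdf_def)
  then have "prob {..c} = 1" using c prob_le_1[of "{..c}"] by simp
  then have le: "AE z in interval_measure F. z \<in> {..c}" by (subst (asm) prob_eq_1) auto
  then have "AE z in interval_measure F. norm (indicator {0..} z *\<^sub>R z ^ k) \<le> \<bar>c\<bar> ^ k"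
    by eventually_elim (auto simp: indicator_def power_mono)
  note bound = this
  have "integrable (interval_measure F) (\<lambda>z. indicator {0..} z *\<^sub>R z ^ k)"
    by (rule integrable_const_bound[OF bound]) measurable
  then have "(LINT z|interval_measure F. norm (indicator {0..} z *\<^sub>R z ^ k)) \<le> \<bar>c\<bar> ^ k"
    by (intro integral_le_const bound integrable_norm)
  then have "norm (LINT z|interval_measure F. indicator {0..} z *\<^sub>R z ^ k) \<le> \<bar>c\<bar> ^ k"
    by (rule order_trans[OF integral_norm_bound])
  then show ?thesis by (simp add: moment_def set_lebesgue_integral_def)
qed

text \<open>The half-lines \<open>{..x}\<close> form an intersection-stable generator on which the
  measures depend measurably on \<open>t\<close>. Hence \<open>t\<close> is mapped measurably into
  the space of probability measures, on which integration of a fixed Borel function is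
  measurable.\<close>

lemma moment_measurable:
  assumes F: "\<And>t. t \<in> space N \<Longrightarrow> distribution_function (F t)"
    and meas: "\<And>z. (\<lambda>t. F t z) \<in> borel_measurable N"
  shows "(\<lambda>t. moment k (F t)) \<in> borel_measurable N"
proof -
  have "(\<lambda>t. interval_measure (F t)) \<in> measurable N (prob_algebra borel)"
  proof (rule measurable_prob_algebra_generated[where \<Omega> = UNIV and G = "range (\<lambda>x::real. {..x})"])
    show "sets borel = sigma_sets UNIV (range (\<lambda>x::real. {..x}))" by (simp add: borel_eq_atMost)
    show "Int_stable (range (\<lambda>x::real. {..x}))" by (auto simp: Int_stable_def)
    fix t assume t: "t \<in> space N"
    interpret real_distribution "interval_measure (F t)"
      by (rule distribution_function_interval_measure[OF F[OF t]])
    show "prob_space (interval_measure (F t))" by (rule prob_space_axioms)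
  next
    fix A :: "real set" assume "A \<in> range (\<lambda>x. {..x})"
    then obtain z where A: "A = {..z}" by auto
    have "emeasure (interval_measure (F t)) A = ennreal (F t z)" if t: "t \<in> space N" for t
    proof -
      interpret real_distribution "interval_measure (F t)"
        by (rule distribution_function_interval_measure[OF F[OF t]])
      show ?thesis
        using distribution_function_interval_measure(2)[OF F[OF t]] unfolding A
        by (metis cdf_def emeasure_eq_measure)
    qed
    then show "(\<lambda>t. emeasure (interval_measure (F t)) A) \<in> borel_measurable N"
      using meas[of z] by (simp cong: measurable_cong)
  qed auto
  then have "(\<lambda>t. interval_measure (F t)) \<in> measurable N (subprob_algebra borel)"
    by (rule measurable_prob_algebraD)
  moreover have "(\<lambda>z::real. indicator {0..} z *\<^sub>R z ^ k) \<in> borel_measurable borel" by measurable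
  ultimately show ?thesis
    unfolding moment_def set_lebesgue_integral_def
    by (rule measurable_compose[OF _ integral_measurable_subprob_algebra])
qed

lemma moment_bounded_measurable_on:
  assumes F: "\<And>t. 0 \<le> t \<Longrightarrow> distribution_function (F t)"
    and meas: "\<And>z. (\<lambda>t. F t z) \<in> borel_measurable (restrict_space borel {0..})"
    and c: "(INF t\<in>{0..}. F t c) = 1"
  shows "bounded_measurable_on {0..} (\<lambda>t. moment k (F t))"
  unfolding bounded_measurable_on_def
proof (intro conjI exI ballI)
  show "(\<lambda>t. moment k (F t)) \<in> borel_measurable (restrict_space borel {0..})"
    by (rule moment_measurable) (use F meas in \<open>auto simp: space_restrict_space\<close>)
  fix t :: real assume t: "t \<in> {0..}"
  \<comment> \<open>The infimum is a lower bound only for a set bounded below, which nonnegativity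
    of distribution functions provides.\<close>
  have "(INF t\<in>{0..}. F t c) \<le> F t c"
    by (rule cINF_lower[OF _ t]) (use F distribution_function_nonneg in \<open>auto intro!: bdd_belowI[where m = 0]\<close>)
  then show "norm (moment k (F t)) \<le> \<bar>c\<bar> ^ k"
    using abs_moment_le[OF F, of t c k] t c by simp
qed

lemma norm_stochastic_matrix_le:
  fixes A :: "real^'s^'s::finite"
  assumes "stochastic_matrix A"
  shows "norm A \<le> real CARD('s) * real CARD('s)"
proof -
  have entry: "norm (A $ x $ y) \<le> 1" for x y
  proof -
    have nonneg: "\<And>x y. 0 \<le> A $ x $ y" and "(\<Sum>y\<in>UNIV. A $ x $ y) = 1"
      using assms by (auto simp: stochastic_matrix_def)
    moreover have "A $ x $ y \<le> (\<Sum>y\<in>UNIV. A $ x $ y)"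
      by (rule member_le_sum) (use nonneg in auto)
    ultimately show ?thesis by simp
  qed
  have row: "norm (A $ x) \<le> real CARD('s)" for x
  proof -
    have "norm (A $ x) \<le> (\<Sum>y\<in>UNIV. norm (A $ x $ y))" unfolding norm_vec_def by (rule L2_set_le_sum) simp
    also have "\<dots> \<le> (\<Sum>y\<in>(UNIV :: 's set). 1)" by (rule sum_mono) (rule entry)
    finally show ?thesis by simp
  qed
  have "norm (A) \<le> (\<Sum>x\<in>UNIV. norm (A $ x))" unfolding norm_vec_def[of "A"] by (rule L2_set_le_sum) simp
  also have "\<dots> \<le> (\<Sum>x\<in>(UNIV :: 's set). real CARD('s))" by (rule sum_mono) (rule row)
  finally show ?thesis by simp
qed

section \<open>The reward model as an instance of the abstract evolution\<close>

context markov_reward_model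
begin

text \<open>Off the diagonal an entry is bounded by assumption if it is a jump rate, and zero
  otherwise, being nonnegative but not positive. The diagonal entry is minus the sum of the others
  in its row.\<close>

lemma Q_entry_bounded: "\<exists>B. \<forall>t\<in>{0..}. norm (Q t $ x $ y) \<le> B"
proof -
  have off: "\<exists>B. \<forall>t\<in>{0..}. norm (Q t $ x $ y) \<le> B" if "x \<noteq> y" for x y
  proof (cases "(x, y) \<in> jumps")
    case True
    obtain B where "\<And>t. t \<in> {0..} \<Longrightarrow> Q t $ x $ y \<le> B"
      using rate_bounds(2)[OF True] by (auto simp: bdd_above_def)
    moreover have "0 \<le> Q t $ x $ y" if "t \<in> {0..}" for t
      using rate_matrices[of t] that \<open>x \<noteq> y\<close> by (auto simp: rate_matrix_def)
    ultimately show ?thesis by (intro exI[of _ B]) auto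
  next
    case False
    then have "Q t $ x $ y = 0" if "t \<in> {0..}" for t
      using rate_matrices[of t] constant_jumps[of t] that \<open>x \<noteq> y\<close>
      by (force simp: rate_matrix_def positive_entries_def)
    then show ?thesis by (intro exI[of _ 0]) auto
  qed
  show ?thesis
  proof (cases "x = y")
    case True
    obtain B where B: "\<And>y t. x \<noteq> y \<Longrightarrow> t \<in> {0..} \<Longrightarrow> norm (Q t $ x $ y) \<le> B y"
      using off[of x] by metis
    have "norm (Q t $ x $ x) \<le> (\<Sum>y\<in>UNIV - {x}. B y)" if t: "t \<in> {0..}" for t
    proof -
      have "(\<Sum>y\<in>UNIV. Q t $ x $ y) = 0" using rate_matrices[of t] t by (simp add: rate_matrix_def)
      then have "Q t $ x $ x = - (\<Sum>y\<in>UNIV - {x}. Q t $ x $ y)"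
        by (simp add: sum.remove[of UNIV x])
      then have "norm (Q t $ x $ x) \<le> (\<Sum>y\<in>UNIV - {x}. norm (Q t $ x $ y))"
        by (simp only: norm_minus_cancel norm_sum)
      also have "\<dots> \<le> (\<Sum>y\<in>UNIV - {x}. B y)" by (rule sum_mono) (use B t in auto)
      finally show ?thesis .
    qed
    then show ?thesis using True by blast
  qed (use off in blast)
qed

lemma Q_bounded_measurable: "bounded_measurable_on {0..} Q"
  using Q_entry_bounded measurable_in_time(1)
  by (auto simp: bounded_measurable_on_vec_iff bounded_measurable_on_def[where 'b = real])

lemma moments_bounded_measurable:
  "bounded_measurable_on {0..} (\<lambda>u. moment k (G u x y))"
  "bounded_measurable_on {0..} (\<lambda>u. moment k (K u x))"
proof -
  obtain c where c: "\<And>x y. (INF t\<in>{0..}. G t x y (c x)) = 1" "\<And>x. (INF t\<in>{0..}. K t x (c x)) = 1"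
    using lump_sum_bounds by metis
  show "bounded_measurable_on {0..} (\<lambda>u. moment k (G u x y))"
    by (rule moment_bounded_measurable_on[where c = "c x"]) (use distribution_functions measurable_in_time c in auto)
  show "bounded_measurable_on {0..} (\<lambda>u. moment k (K u x))"
    by (rule moment_bounded_measurable_on[where c = "c x"]) (use distribution_functions measurable_in_time c in auto)
qed

lemma rates_bounded_measurable:
  "bounded_measurable_on {0..} (\<lambda>u. r u $ x)" "bounded_measurable_on {0..} (\<lambda>u. \<beta> u $ x)"
proof -
  obtain B where "\<And>u. u \<in> {0..} \<Longrightarrow> r u $ x \<le> B"
    using reward_rate_bounds(2)[of x] by (auto simp: bdd_above_def)
  then have "\<forall>u\<in>{0..}. norm (r u $ x) \<le> B" using reward_rate_bounds(1) by auto
  then show "bounded_measurable_on {0..} (\<lambda>u. r u $ x)"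
    using measurable_in_time(2) by (auto simp: bounded_measurable_on_def)
  obtain B where "\<And>u. u \<in> {0..} \<Longrightarrow> \<beta> u $ x \<le> B"
    using intensity_bounds(2)[of x] by (auto simp: bdd_above_def)
  then have "\<forall>u\<in>{0..}. norm (\<beta> u $ x) \<le> B" using intensity_bounds(1) by auto
  then show "bounded_measurable_on {0..} (\<lambda>u. \<beta> u $ x)"
    using measurable_in_time(5) by (auto simp: bounded_measurable_on_def)
qed

lemma Q_entry_bounded_measurable: "bounded_measurable_on {0..} (\<lambda>u. Q u $ x $ y)"
  using Q_bounded_measurable by (simp add: bounded_measurable_on_vec_iff)

lemmas model_bounded_measurable =
  Q_entry_bounded_measurable moments_bounded_measurable rates_bounded_measurable

lemma r_tilde_bounded_measurable: "bounded_measurable_on {0..} r_tilde"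
  unfolding bounded_measurable_on_vec_iff
  by (simp add: r_tilde_def \<gamma>_def) (intro allI bounded_measurable_on_intros model_bounded_measurable)

lemma \<phi>_bounded_measurable:
  assumes "bounded_measurable_on {0..t} (m t)"
  shows "bounded_measurable_on {0..t} (\<phi> t)"
proof -
  have "bounded_measurable_on {0..t} (\<lambda>u. m t u $ x)" for x
    using assms by (simp add: bounded_measurable_on_vec_iff)
  then show ?thesis
    unfolding bounded_measurable_on_vec_iff
    by (simp add: \<phi>_def)
       (intro allI bounded_measurable_on_intros bounded_measurable_on_subset[OF Q_entry_bounded_measurable]
          bounded_measurable_on_subset[OF moments_bounded_measurable(1)]
          bounded_measurable_on_subset[OF moments_bounded_measurable(2)]
          bounded_measurable_on_subset[OF rates_bounded_measurable(1)]
          bounded_measurable_on_subset[OF rates_bounded_measurable(2)]; simp)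
qed

text \<open>\<open>Sup\<close> of a set of naturals is its maximum only if the set is finite and
  nonempty: finite because \<open>T\<close> tends to infinity, nonempty because
  \<open>T 0 = 0 \<le> t\<close>.\<close>

lemma n0_bounds:
  assumes "0 \<le> t"
  shows "1 \<le> n0 t" "\<And>i. i < n0 t \<Longrightarrow> T i \<le> t"
proof -
  let ?I = "{i. T i \<le> t}"
  have "eventually (\<lambda>i. t < T i) sequentially"
    using scheduled_times(3) by (simp add: filterlim_at_top_dense)
  then obtain k where k: "\<And>i. i \<ge> k \<Longrightarrow> t < T i" by (auto simp: eventually_sequentially)
  have "?I \<subseteq> {..k}"
  proof
    fix i assume "i \<in> ?I"
    then have "\<not> k \<le> i" using k[of i] by auto
    then show "i \<in> {..k}" by simp
  qed
  then have fin: "finite ?I" by (rule finite_subset) simp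
  have "0 \<in> ?I" using scheduled_times(1) assms by simp
  then have "Sup ?I \<in> ?I" using fin by (metis Max_in Sup_nat_def empty_iff)
  then have *: "T (Sup ?I) \<le> t" by simp
  show "1 \<le> n0 t" by (simp add: n0_def)
  fix i assume "i < n0 t"
  then have "i \<le> Sup ?I" by (simp add: n0_def)
  then have "T i \<le> T (Sup ?I)" using scheduled_times(2) by (simp add: strict_mono_less_eq)
  with * show "T i \<le> t" by simp
qed

text \<open>If \<open>t\<close> is itself a scheduled time, then \<open>\<tau> t (n0 t - 1)\<close>
  and \<open>\<tau> t (n0 t)\<close> both equal \<open>t\<close>. Strict increase is therefore
  claimed only from times below \<open>t\<close>.\<close>

lemma \<tau>_properties:
  assumes "0 \<le> t"
  shows "\<tau> t 0 = 0" "\<tau> t (n0 t) = t"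
    "\<And>i j. i \<le> j \<Longrightarrow> j \<le> n0 t \<Longrightarrow> \<tau> t i \<le> \<tau> t j"
    "\<And>i j. i < j \<Longrightarrow> j \<le> n0 t \<Longrightarrow> \<tau> t i < t \<Longrightarrow> \<tau> t i < \<tau> t j"
proof -
  show "\<tau> t 0 = 0" using n0_bounds(1)[OF assms] scheduled_times(1) by (simp add: \<tau>_def)
  show "\<tau> t (n0 t) = t" by (simp add: \<tau>_def)
  fix i j
  show "\<tau> t i \<le> \<tau> t j" if "i \<le> j" "j \<le> n0 t"
    using that n0_bounds(2)[OF assms, of i] scheduled_times(2) by (auto simp: \<tau>_def strict_mono_less_eq)
  show "\<tau> t i < \<tau> t j" if "i < j" "j \<le> n0 t" "\<tau> t i < t"
    using that scheduled_times(2) by (auto simp: \<tau>_def strict_mono_less)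
qed

lemma bounded_evolution_P_Q:
  obtains p q where "bounded_evolution P Q p q"
proof -
  obtain q where "\<And>u. 0 \<le> u \<Longrightarrow> norm (Q u) \<le> q"
    using Q_bounded_measurable by (auto simp: bounded_measurable_on_def)
  moreover have "Q \<in> borel_measurable (restrict_space borel {0..})"
    using Q_bounded_measurable by (simp add: bounded_measurable_on_def)
  ultimately show ?thesis
    by (intro that bounded_evolution.intro)
       (auto intro: norm_stochastic_matrix_le stochastic chapman_kolmogorov forward_integrable forward_equation)
qed

lemma jump_evolution_exists:
  assumes "bounded_evolution P Q p q" "0 \<le> t" "bounded_measurable_on {0..t} f"
  obtains F where "jump_evolution P Q p q f (\<tau> t) (n0 t) t F"
proof -
  obtain F where F: "\<forall>u\<in>{0..t}. norm (f u) \<le> F" and f: "f \<in> borel_measurable (restrict_space borel {0..t})"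
    using assms(3) by (auto simp: bounded_measurable_on_def)
  have "jump_evolution P Q p q f (\<tau> t) (n0 t) t F"
    by (intro jump_evolution.intro jump_evolution_axioms.intro assms(1) \<tau>_properties[OF assms(2)] f)
       (use F in auto)
  then show ?thesis by (rule that)
qed

text \<open>As \<open>\<phi>\<close> contains \<open>m\<close>, the jump locale has to be used with
  \<open>r_tilde\<close> and \<open>h\<close> before its hypotheses can be met for
  \<open>\<phi>\<close>.\<close>

lemma m_bounded_measurable:
  assumes "0 \<le> t"
  shows "bounded_measurable_on {0..t} (m t)"
proof -
  obtain p q where pq: "bounded_evolution P Q p q" by (rule bounded_evolution_P_Q)
  have "bounded_measurable_on {0..t} r_tilde"
    by (rule bounded_measurable_on_subset[OF r_tilde_bounded_measurable]) auto
  then obtain F where "jump_evolution P Q p q r_tilde (\<tau> t) (n0 t) t F"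
    using jump_evolution_exists[OF pq assms] by blast
  then interpret jump_evolution P Q p q r_tilde "h t" "\<tau> t" "n0 t" t F .
  have "m t = w" by (rule ext) (simp add: m_def jump_value_def)
  then show ?thesis
    using value_measurable value_bounded unfolding bounded_measurable_on_def by metis
qed

end

theorem proposition8:
  fixes M :: "'w measure"
    and X :: "real \<Rightarrow> 'w \<Rightarrow> 's::finite"
    and Q :: "real \<Rightarrow> real^'s^'s"
    and P :: "real \<Rightarrow> real \<Rightarrow> real^'s^'s"
    and r \<beta> :: "real \<Rightarrow> real^'s"
    and G :: "real \<Rightarrow> 's \<Rightarrow> 's \<Rightarrow> real \<Rightarrow> real"
    and H K :: "real \<Rightarrow> 's \<Rightarrow> real \<Rightarrow> real"
    and T :: "nat \<Rightarrow> real"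
    and t :: real
  assumes "markov_reward_model M X Q P r \<beta> G H K T" and "0 < t"
  shows "let n0 = reward_data.n0 T t;
             \<tau> = reward_data.\<tau> T t;
             \<phi> = reward_data.\<phi> Q P r \<beta> G H K T t;
             h_tilde = reward_data.h_tilde Q P r \<beta> G H K T t;
             v = reward_data.v Q P r \<beta> G H K T t;
             v_plus = reward_data.v_plus Q P r \<beta> G H K T t
         in (\<forall>i\<in>{1..n0}. \<forall>s. \<tau> (i - 1) < s \<and> s \<le> \<tau> i \<longrightarrow>
               v s = (LBINT u:{s..\<tau> i}. \<phi> u) + (LBINT u:{s..\<tau> i}. Q u *v v u) + v (\<tau> i)) \<and>
            v (\<tau> n0) = 0 \<and>
            (AE s in lborel. s \<in> {0..t} \<longrightarrow> v differentiable (at s)) \<and>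
            (\<forall>i\<in>{1..n0}. AE s in lborel. 0 \<le> s \<and> s < \<tau> i - \<tau> (i - 1) \<longrightarrow>
               ((\<lambda>s. v (\<tau> i - s)) has_vector_derivative
                  \<phi> (\<tau> i - s) + Q (\<tau> i - s) *v v (\<tau> i - s)) (at s)) \<and>
            (\<forall>i\<in>{1..n0}. (\<tau> i < t \<longrightarrow> (v \<longlongrightarrow> v_plus (\<tau> i)) (at_right (\<tau> i))) \<and>
               v (\<tau> i) = h_tilde (\<tau> i) + v_plus (\<tau> i))"
proof -
  interpret markov_reward_model M X Q P r \<beta> G H K T by fact
  have t: "0 \<le> t" using assms(2) by simp
  obtain p q where pq: "bounded_evolution P Q p q" by (rule bounded_evolution_P_Q)
  obtain F where "jump_evolution P Q p q (\<phi> t) (\<tau> t) (n0 t) t F"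
    using jump_evolution_exists[OF pq t \<phi>_bounded_measurable[OF m_bounded_measurable[OF t]]] by blast
  then interpret jump_evolution P Q p q "\<phi> t" "h_tilde t" "\<tau> t" "n0 t" t F .
  have v: "v t = w" by (rule ext) (simp add: v_def jump_value_def)
  have v_end: "v t t = 0" unfolding v by (rule value_at_end) (simp add: h_tilde_def)
  have jump: "(\<tau> t i < t \<longrightarrow> (v t \<longlongrightarrow> v_plus t (\<tau> t i)) (at_right (\<tau> t i))) \<and>
      v t (\<tau> t i) = h_tilde t (\<tau> t i) + v_plus t (\<tau> t i)" if i: "i \<in> {1..n0 t}" for i
  proof (cases "\<tau> t i < t")
    case True
    then have "i < n0 t" using i finish by (cases "i = n0 t") auto
    from value_right_limit[OF this True] obtain l where
      l: "(v t \<longlongrightarrow> l) (at_right (\<tau> t i))" "v t (\<tau> t i) = h_tilde t (\<tau> t i) + l"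
      unfolding v by blast
    \<comment> \<open>\<open>Lim\<close> is defined by choice, so it is identified only after the
      limit has been shown to exist.\<close>
    have "v_plus t (\<tau> t i) = l"
      using True tendsto_Lim[OF _ l(1)] by (simp add: v_plus_def)
    with l show ?thesis by simp
  next
    \<comment> \<open>Here \<open>i = n0 t\<close>, or \<open>i = n0 t - 1\<close> with
      \<open>t\<close> scheduled. In both cases \<open>v\<close>, \<open>h_tilde\<close> and
      \<open>v_plus\<close> are all zero.\<close>
    case False
    then have "\<tau> t i = t" using tau_in[of i] i by auto
    then show ?thesis by (simp add: v_end v_plus_def h_tilde_def)
  qed
  show ?thesis
    unfolding Let_def finish
  proof (intro conjI ballI allI impI)
    fix i s assume i: "i \<in> {1..n0 t}" and s: "\<tau> t (i - 1) < s \<and> s \<le> \<tau> t i"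
    then show "v t s = (LBINT u:{s..\<tau> t i}. \<phi> t u) + (LBINT u:{s..\<tau> t i}. Q u *v v t u) + v t (\<tau> t i)"
      using value_integral_equation[of i s] by (simp add: v)
  next
    show "v t t = 0" by (rule v_end)
  next
    show "AE s in lborel. s \<in> {0..t} \<longrightarrow> v t differentiable (at s)"
      unfolding v by (rule value_differentiable_AE)
  next
    fix i assume "i \<in> {1..n0 t}"
    then show "AE s in lborel. 0 \<le> s \<and> s < \<tau> t i - \<tau> t (i - 1) \<longrightarrow>
        ((\<lambda>s. v t (\<tau> t i - s)) has_vector_derivative
          \<phi> t (\<tau> t i - s) + Q (\<tau> t i - s) *v v t (\<tau> t i - s)) (at s)"
      unfolding v by (intro reversed_value_has_derivative_AE) auto
  qed (use jump in blast)+
qed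

end
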